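(* Let $A$ be a finite set, and let $Z=(Z_n)_{n\ge1}=((X_n,K_n))_{n\ge1}$ be the regime switching process on $A\times\mathbb N_+$ with letter distributions $P_a=(p_{a,k})_{k\ge1}$, $a\in A$, whose underlying process $X$ is an aperiodic and irreducible Markov chain on $A$ with transition operator $Q$, stationary distribution $\pi=(\pi_a)_{a\in A}$ and initial distribution $\eta=(\eta_a)_{a\in A}$. Let $\pi_\wedge=\min_{a\in A}\pi_a$, let $t_0\ge1$ be an integer with $Q^{t_0}(a,b)>0$ for all $a,b\in A$, and let $$\lambda=|A|\min\Big\{\min_{a,b\in A}Q^{t_0}(a,b),\ \min_{a,b\in A}\hat Q^{t_0}(a,b)\Big\},\qquad \hat Q(x,y)=\frac{\pi_yQ(y,x)}{\pi_x}.$$ Assume further that for some $\alpha\in[0,1]$ and some non-increasing slowly varying function $\ell$ we have $\nu(a,\epsilon)\le\epsilon^{-\alpha}\ell(1/\epsilon)$ for all $a\in A$ and $\epsilon\in(0,1]$. Let $r\ge0$ be an integer. For any $\epsilon\in(0,\pi_\wedge)$, if $$n>\max\left\{\frac{2t_0+r\lambda+\lambda(1-\pi_\wedge)}{\lambda\pi_\wedge},\ \frac{2t_0+\lambda(1-\pi_\wedge)}{\lambda(\pi_\wedge-\epsilon)}\right\},$$ then $\mathbf P_\eta\{\mathcal L_n=r\}\le H(n,\epsilon)$, where $$H(n,\epsilon)=c_1(\alpha,r)(n\epsilon)^{-(1-\alpha)}\ell(n\epsilon)+c_2(\alpha,r)\,C\exp\left(-\frac n2\left(\frac{\lambda\pi_\wedge}{t_0}-\frac{2+(r+1)\lambda/t_0}{n}\right)^2\right)$$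 $$\qquad\qquad+c_3(\alpha,r)\,C\exp\left(-\frac n2\left(\frac{\lambda(\pi_\wedge-\epsilon)}{t_0}-\frac{2+\lambda/t_0}{n}\right)^2\right),$$ with $C=\min\{|A|,\max_{a\in A}(\eta_a/\pi_a)\}$ and the constants $$c_1(\alpha,r)=c(r)+\frac{4^{1+r}}{r!}(1+r)^{1+r-\alpha}\gamma\left(1+r-\alpha,\tfrac12\right),\qquad c_2(\alpha,r)=\begin{cases}1&r=0,\\ \min\{1,p_\vee^{r+1}r^\alpha\ell(r)+r^{-r}\}&r\ge1,\end{cases}$$ $$c_3(\alpha,r)=c_1(\alpha,r)(r+1)^{-(1-\alpha)}\ell(r+1).$$
   Context: $\mathbb N_+=\{1,2,\dots\}$; each $P_a$ is a probability distribution on $\mathbb N_+$. Regime switching process with Markov underlying process: $Z=((X_n,K_n))_{n\ge1}$ is the Markov chain on $A\times\mathbb N_+$ with $\mathbf P_\eta\{Z_1=(a,k)\}=\eta_ap_{a,k}$ and transition probabilities $\mathcal Q((a',k'),(a,k))=Q(a',a)p_{a,k}$ (so $X$ is a Markov chain with transition operator $Q$ and initial distribution $\eta$). Set $\mathcal L_n=\sum_{i=1}^n\mathbf 1\{Z_i=Z_{n+1}\}$. The $t$-step transition operators are $Q^t$, $\hat Q^t$. The counting function of $P_a$ is $\nu(a,\epsilon)=\sum_{k\ge1}\mathbf 1\{p_{a,k}\ge\epsilon\}$. A function $\ell:(0,\infty)\to\mathbb R$ is slowly varying (at $+\infty$) if $\lim_{x\to\infty}\ell(cx)/\ell(x)=1$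 for every $c>0$. Further, $p_\vee=\sup\{p_{a,k}:(a,k)\in A\times\mathbb N_+\}$, $\gamma(t,x)=\int_0^xu^{t-1}e^{-u}\,du$ (with $\gamma(0,1/2)=+\infty$, so the bound is trivial for $\alpha=1,r=0$), and $c(0)=e^{-1}$, $c(r)=e(1+r)/\sqrt{3.14159\ldots}$ for $r\ge1$ (the constant under the root is the number pi, not the stationary distribution). *)

theory Defs
  imports "HOL-Probability.Probability"
begin

text \<open>
  The finite alphabet \<open>A\<close> is a type of class \<^class>\<open>finite\<close>. A transition operator on it is a
  kernel \<open>Q :: 'a \<Rightarrow> 'a pmf\<close> with entries \<open>Q(x,y) = pmf (Q x) y\<close>; the letter distribution \<open>P a\<close> is a
  \<^typ>\<open>nat pmf\<close> supported in \<open>{1..}\<close>.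
\<close>

abbreviation trans_mat :: "('a \<Rightarrow> 'a pmf) \<Rightarrow> 'a \<Rightarrow> 'a \<Rightarrow> real" where
  "trans_mat Q \<equiv> (\<lambda>x y. pmf (Q x) y)"

primrec kernel_power :: "('a::finite \<Rightarrow> 'a \<Rightarrow> real) \<Rightarrow> nat \<Rightarrow> 'a \<Rightarrow> 'a \<Rightarrow> real" where
  "kernel_power K 0 = (\<lambda>x y. of_bool (x = y))"
| "kernel_power K (Suc t) = (\<lambda>x y. \<Sum>z\<in>UNIV. K x z * kernel_power K t z y)"

definition irreducible_kernel :: "('a::finite \<Rightarrow> 'a \<Rightarrow> real) \<Rightarrow> bool" where
  "irreducible_kernel K \<longleftrightarrow> (\<forall>x y. \<exists>t. kernel_power K t x y > 0)"

definition aperiodic_kernel :: "('a::finite \<Rightarrow> 'a \<Rightarrow> real) \<Rightarrow> bool" where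
  "aperiodic_kernel K \<longleftrightarrow> (\<forall>x. Gcd {t. t \<ge> 1 \<and> kernel_power K t x x > 0} = 1)"

definition stationary :: "('a \<Rightarrow> 'a pmf) \<Rightarrow> 'a pmf \<Rightarrow> bool" where
  "stationary Q \<pi> \<longleftrightarrow> bind_pmf \<pi> Q = \<pi>"

definition reversed_kernel :: "('a \<Rightarrow> 'a pmf) \<Rightarrow> 'a pmf \<Rightarrow> 'a \<Rightarrow> 'a \<Rightarrow> real" where
  "reversed_kernel Q \<pi> x y = pmf \<pi> y * pmf (Q y) x / pmf \<pi> x"

text \<open>
  Time-homogeneous Markov chain \<open>Z\<^sub>1, Z\<^sub>2, \<dots>\<close> with values in a countable set \<open>S\<close>, initial mass
  function \<open>init\<close> and transition probabilities \<open>K\<close>. The process is indexed by \<open>n \<ge> 1\<close>;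
  \<open>Z 0\<close> is irrelevant.
\<close>

definition markov_chain ::
    "'w measure \<Rightarrow> 's set \<Rightarrow> (nat \<Rightarrow> 'w \<Rightarrow> 's) \<Rightarrow> ('s \<Rightarrow> real) \<Rightarrow> ('s \<Rightarrow> 's \<Rightarrow> real) \<Rightarrow> bool" where
  "markov_chain M S Z init K \<longleftrightarrow>
     prob_space M \<and>
     (\<forall>n\<ge>1. Z n \<in> M \<rightarrow>\<^sub>M count_space S) \<and>
     (\<forall>z\<in>S. \<P>(w in M. Z 1 w = z) = init z) \<and>
     (\<forall>n\<ge>1. \<forall>z. (\<forall>i\<in>{1..Suc n}. z i \<in> S) \<longrightarrow>
        \<P>(w in M. \<forall>i\<in>{1..n}. Z i w = z i) > 0 \<longrightarrow>
        \<P>(w in M. Z (Suc n) w = z (Suc n) \<bar> \<forall>i\<in>{1..n}. Z i w = z i) = K (z n) (z (Suc n)))"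

definition regime_switching ::
    "'w measure \<Rightarrow> (nat \<Rightarrow> 'w \<Rightarrow> 'a \<times> nat) \<Rightarrow> ('a \<Rightarrow> nat pmf) \<Rightarrow> ('a \<Rightarrow> 'a pmf) \<Rightarrow> 'a pmf \<Rightarrow> bool" where
  "regime_switching M Z P Q \<eta> \<longleftrightarrow>
     markov_chain M (UNIV \<times> {1..}) Z
       (\<lambda>(a, k). pmf \<eta> a * pmf (P a) k)
       (\<lambda>(a', k') (a, k). pmf (Q a') a * pmf (P a) k)"

definition num_matches :: "(nat \<Rightarrow> 'w \<Rightarrow> 's) \<Rightarrow> nat \<Rightarrow> 'w \<Rightarrow> nat" where
  "num_matches Z n w = (\<Sum>i=1..n. of_bool (Z i w = Z (Suc n) w))"

text \<open>For \<open>\<epsilon> > 0\<close> the set below has at most \<open>1/\<epsilon>\<close> elements.\<close>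

definition counting_fun :: "('a \<Rightarrow> nat pmf) \<Rightarrow> 'a \<Rightarrow> real \<Rightarrow> real" where
  "counting_fun P a \<epsilon> = real (card {k. k \<ge> 1 \<and> pmf (P a) k \<ge> \<epsilon>})"

definition slowly_varying :: "(real \<Rightarrow> real) \<Rightarrow> bool" where
  "slowly_varying L \<longleftrightarrow> (\<forall>c>0. ((\<lambda>x. L (c * x) / L x) \<longlongrightarrow> 1) at_top)"

definition pi_min :: "'a::finite pmf \<Rightarrow> real" where
  "pi_min \<pi> = (MIN a. pmf \<pi> a)"

definition mixing_const :: "('a::finite \<Rightarrow> 'a pmf) \<Rightarrow> 'a pmf \<Rightarrow> nat \<Rightarrow> real" where
  "mixing_const Q \<pi> t0 = real CARD('a) *
     min (MIN a. MIN b. kernel_power (trans_mat Q) t0 a b)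
         (MIN a. MIN b. kernel_power (reversed_kernel Q \<pi>) t0 a b)"

definition p_sup :: "('a \<Rightarrow> nat pmf) \<Rightarrow> real" where
  "p_sup P = (SUP (a, k) \<in> UNIV \<times> {1..}. pmf (P a) k)"

definition init_const :: "'a::finite pmf \<Rightarrow> 'a pmf \<Rightarrow> real" where
  "init_const \<eta> \<pi> = min (real CARD('a)) (MAX a. pmf \<eta> a / pmf \<pi> a)"

text \<open>
  The lower incomplete gamma function is extended-valued: the integral diverges for \<open>t = 0\<close> and
  \<open>x > 0\<close>, so then \<open>lower_gamma t x = \<infinity>\<close>. Hence \<open>c\<^sub>1\<close>, \<open>c\<^sub>3\<close> and the final bound take values in
  \<^typ>\<open>ereal\<close>; all summands are non-negative in the theorem, so no \<open>\<infinity> - \<infinity>\<close> occurs.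
\<close>

definition lower_gamma :: "real \<Rightarrow> real \<Rightarrow> ennreal" where
  "lower_gamma t x = (\<integral>\<^sup>+ u\<in>{0<..<x}. ennreal (u powr (t - 1) * exp (- u)) \<partial>lborel)"

definition c0 :: "nat \<Rightarrow> real" where
  "c0 r = (if r = 0 then exp (- 1) else exp 1 * (1 + real r) / sqrt pi)"

definition c1 :: "real \<Rightarrow> nat \<Rightarrow> ereal" where
  "c1 \<alpha> r = ereal (c0 r) +
     ereal (4 ^ (1 + r) / fact r * (1 + real r) powr (1 + real r - \<alpha>)) *
     enn2ereal (lower_gamma (1 + real r - \<alpha>) (1 / 2))"

definition c2 :: "('a \<Rightarrow> nat pmf) \<Rightarrow> (real \<Rightarrow> real) \<Rightarrow> real \<Rightarrow> nat \<Rightarrow> real" where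
  "c2 P L \<alpha> r = (if r = 0 then 1
     else min 1 (p_sup P ^ (r + 1) * real r powr \<alpha> * L (real r) + real r powr (- real r)))"

definition c3 :: "(real \<Rightarrow> real) \<Rightarrow> real \<Rightarrow> nat \<Rightarrow> ereal" where
  "c3 L \<alpha> r = c1 \<alpha> r * ereal ((real r + 1) powr (- (1 - \<alpha>)) * L (real r + 1))"

definition H_bound ::
    "('a::finite \<Rightarrow> nat pmf) \<Rightarrow> ('a \<Rightarrow> 'a pmf) \<Rightarrow> 'a pmf \<Rightarrow> 'a pmf \<Rightarrow> nat \<Rightarrow> real \<Rightarrow> (real \<Rightarrow> real) \<Rightarrow>
     nat \<Rightarrow> nat \<Rightarrow> real \<Rightarrow> ereal" where
  "H_bound P Q \<pi> \<eta> t0 \<alpha> L r n \<epsilon> =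
    (let lam = mixing_const Q \<pi> t0; C = init_const \<eta> \<pi> in
     c1 \<alpha> r * ereal ((real n * \<epsilon>) powr (- (1 - \<alpha>)) * L (real n * \<epsilon>))
     + ereal (c2 P L \<alpha> r * C *
         exp (- (real n / 2) *
           (lam * pi_min \<pi> / real t0 - (2 + (real r + 1) * lam / real t0) / real n)\<^sup>2))
     + c3 L \<alpha> r * ereal (C *
         exp (- (real n / 2) *
           (lam * (pi_min \<pi> - \<epsilon>) / real t0 - (2 + lam / real t0) / real n)\<^sup>2)))"

end

theory Submission
  imports Defs
begin

text \<open>
  Conditionally on the trajectory of \<open>X\<close>, the number of matches is binomial with \<open>N\<close> tosses, where \<open>N\<close>
  counts the visits of \<open>X\<^sub>1, \<dots>, X\<^sub>n\<close> to \<open>X\<^sub>n\<^sub>+\<^sub>1\<close> and the success probability is that of the last letter. The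
  conditional match probability is therefore a single-distribution quantity, which the counting
  function bounds by a power of \<open>N\<close> as soon as \<open>N > r\<close>, and it vanishes for \<open>N < r\<close>. It remains to show that \<open>N\<close> is
  rarely small. For a fixed state \<open>a\<close> the Laplace transform of the number of visits is an iterate of
  a tilted transition operator; Hoeffding's lemma is applied in each step to the expected number of
  remaining visits, whose oscillation is at most \<open>t\<^sub>0 / \<lambda>\<close> by Doeblin's contraction. The random state \<open>X\<^sub>n\<^sub>+\<^sub>1\<close> is
  dealt with by a union bound, which gives the factor \<open>|A|\<close>, or by passing to the stationary chain
  and reversing time, which makes \<open>X\<^sub>n\<^sub>+\<^sub>1\<close> the initial state and gives the factor \<open>max \<eta>\<^sub>a / \<pi>\<^sub>a\<close>.
\<close>

section \<open>Oscillation and visit counts of finite chains\<close>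

definition kernel_app :: "('a::finite \<Rightarrow> 'a \<Rightarrow> real) \<Rightarrow> ('a \<Rightarrow> real) \<Rightarrow> 'a \<Rightarrow> real" where
  "kernel_app K g x = (\<Sum>y\<in>UNIV. K x y * g y)"

text \<open>Kernels are kept as real matrices because the time reversal is given only by its
  entries.\<close>

definition stochastic :: "('a::finite \<Rightarrow> 'a \<Rightarrow> real) \<Rightarrow> bool" where
  "stochastic K \<longleftrightarrow> (\<forall>x y. 0 \<le> K x y) \<and> (\<forall>x. (\<Sum>y\<in>UNIV. K x y) = 1)"

definition osc_le :: "('a \<Rightarrow> real) \<Rightarrow> real \<Rightarrow> bool" where
  "osc_le g d \<longleftrightarrow> (\<forall>x y. g x - g y \<le> d)"

lemma stochasticD: "stochastic K \<Longrightarrow> 0 \<le> K x y" "stochastic K \<Longrightarrow> (\<Sum>y\<in>UNIV. K x y) = 1"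
  by (auto simp: stochastic_def)

lemma kernel_app_mono:
  assumes "stochastic K" "\<And>y. g y \<le> h y"
  shows "kernel_app K g x \<le> kernel_app K h x"
  unfolding kernel_app_def using assms by (intro sum_mono mult_left_mono) (auto simp: stochastic_def)

lemma kernel_app_const: "stochastic K \<Longrightarrow> kernel_app K (\<lambda>_. c) x = c"
  by (simp add: kernel_app_def stochastic_def flip: sum_distrib_right)

lemma kernel_app_sum: "kernel_app K (\<lambda>y. \<Sum>i\<in>I. g i y) x = (\<Sum>i\<in>I. kernel_app K (g i) x)"
  unfolding kernel_app_def sum_distrib_left by (rule sum.swap)

text \<open>Powers are defined by splitting off the first step; time reversal needs the last step
  split off instead.\<close>

lemma kernel_power_commute:
  "(\<Sum>z\<in>UNIV. kernel_power K t x z * K z y) = (\<Sum>z\<in>UNIV. K x z * kernel_power K t z y)"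
proof (induction t arbitrary: x)
  case 0
  have "(\<Sum>z\<in>UNIV. of_bool (x = z) * K z y) = K x y"
    by (subst sum.remove[of _ x]) auto
  moreover have "(\<Sum>z\<in>UNIV. K x z * of_bool (z = y)) = K x y"
    by (subst sum.remove[of _ y]) auto
  ultimately show ?case by simp
next
  case (Suc t)
  have "(\<Sum>z\<in>UNIV. kernel_power K (Suc t) x z * K z y)
      = (\<Sum>w\<in>UNIV. K x w * (\<Sum>z\<in>UNIV. kernel_power K t w z * K z y))"
    unfolding kernel_power.simps sum_distrib_left sum_distrib_right
    by (subst sum.swap) (simp add: mult.assoc)
  then show ?case by (simp add: Suc)
qed

lemma kernel_app_power: "kernel_app (kernel_power K t) g = (kernel_app K ^^ t) g"
proof (induction t)
  case 0
  show ?case by (rule ext) (simp add: kernel_app_def of_bool_def if_distrib[of "\<lambda>c. c * _"] cong: if_cong)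
next
  case (Suc t)
  have "kernel_app (kernel_power K (Suc t)) g x = kernel_app K (kernel_app (kernel_power K t) g) x" for x
    unfolding kernel_app_def kernel_power.simps sum_distrib_left sum_distrib_right
    by (subst sum.swap) (simp add: mult.assoc)
  then show ?case using Suc by auto
qed

lemma stochastic_power:
  assumes "stochastic K"
  shows "stochastic (kernel_power K t)"
proof (induction t)
  case 0
  show ?case by (simp add: stochastic_def of_bool_def)
next
  case (Suc t)
  have "(\<Sum>y\<in>UNIV. kernel_power K (Suc t) x y) = 1" for x
    unfolding kernel_power.simps by (subst sum.swap)
      (simp add: stochasticD[OF Suc] stochasticD[OF assms] flip: sum_distrib_left)
  then show ?case
    using stochasticD[OF Suc] stochasticD[OF assms] unfolding stochastic_def
    by (auto intro!: sum_nonneg)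
qed

lemma stationary_kernel_app:
  assumes "\<And>y. (\<Sum>x\<in>UNIV. w x * K x y) = w y"
  shows "(\<Sum>x\<in>UNIV. w x * kernel_app K g x) = (\<Sum>x\<in>UNIV. w x * g x)"
proof -
  have "(\<Sum>x\<in>UNIV. w x * kernel_app K g x) = (\<Sum>y\<in>UNIV. (\<Sum>x\<in>UNIV. w x * K x y) * g y)"
    unfolding kernel_app_def sum_distrib_left sum_distrib_right
    by (subst sum.swap) (simp add: mult.assoc)
  then show ?thesis by (simp add: assms)
qed

text \<open>Doeblin contraction: the part \<open>\<mu>\<close> common to all entries cancels in differences.\<close>

lemma osc_le_kernel_app:
  fixes K :: "'a::finite \<Rightarrow> 'a \<Rightarrow> real"
  assumes K: "stochastic K" "\<And>x y. \<mu> \<le> K x y" and g: "osc_le g d"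
  shows "osc_le (kernel_app K g) ((1 - real CARD('a) * \<mu>) * d)"
  unfolding osc_le_def
proof (intro allI)
  fix x y
  define q where "q = 1 - real CARD('a) * \<mu>"
  define hi lo where "hi = (MAX z. g z)" and "lo = (MIN z. g z)"
  have R: "(\<Sum>z\<in>UNIV. K u z - \<mu>) = q" for u
    by (simp add: sum_subtractf stochasticD[OF K(1)] q_def)
  have q: "0 \<le> q" using K(2) by (subst R[symmetric]) (auto intro!: sum_nonneg)
  have "hi \<in> range g" "lo \<in> range g" unfolding hi_def lo_def by (auto intro!: Max_in Min_in)
  then have d: "hi - lo \<le> d" using g by (auto simp: osc_le_def)
  have *: "kernel_app K g u = (\<Sum>z\<in>UNIV. (K u z - \<mu>) * g z) + \<mu> * (\<Sum>z\<in>UNIV. g z)" for u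
    by (simp add: kernel_app_def left_diff_distrib sum_subtractf sum_distrib_left)
  have "(\<Sum>z\<in>UNIV. (K x z - \<mu>) * g z) \<le> (\<Sum>z\<in>UNIV. (K x z - \<mu>) * hi)"
    using K(2) by (intro sum_mono mult_left_mono) (auto simp: hi_def)
  moreover have "(\<Sum>z\<in>UNIV. (K y z - \<mu>) * lo) \<le> (\<Sum>z\<in>UNIV. (K y z - \<mu>) * g z)"
    using K(2) by (intro sum_mono mult_left_mono) (auto simp: lo_def)
  ultimately have "kernel_app K g x - kernel_app K g y \<le> q * hi - q * lo"
    by (simp add: * R flip: sum_distrib_right)
  also have "\<dots> \<le> q * d" using q d by (simp add: mult_left_mono flip: right_diff_distrib)
  finally show "kernel_app K g x - kernel_app K g y \<le> q * d" .
qed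

text \<open>The \<open>k\<close> steps consist of \<open>k div t0\<close> blocks of length
  \<open>t0\<close>, each contracting by Doeblin's factor, and fewer than \<open>t0\<close> leftover
  steps, which do not increase the oscillation.\<close>

lemma osc_le_iterate:
  fixes K :: "'a::finite \<Rightarrow> 'a \<Rightarrow> real"
  assumes K: "stochastic K" "\<And>x y. \<mu> \<le> kernel_power K t0 x y" and t0: "t0 \<ge> 1" and g: "osc_le g d"
  shows "osc_le ((kernel_app K ^^ k) g) ((1 - real CARD('a) * \<mu>) ^ (k div t0) * d)"
proof (induction k rule: less_induct)
  case (less k)
  show ?case
  proof (cases "k < t0")
    case True
    have "osc_le ((kernel_app K ^^ j) g) d" for j
    proof (induction j)
      case (Suc j)
      \<comment> \<open>With the trivial minorant \<open>0\<close> the contraction factor is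
        1.\<close>
      from osc_le_kernel_app[OF K(1) _ Suc, of 0] K(1) show ?case by (auto simp: stochastic_def)
    qed (use g in simp)
    then show ?thesis using True by simp
  next
    case False
    then have k: "k div t0 = Suc ((k - t0) div t0)" using t0 by (simp add: le_div_geq)
    have "osc_le ((kernel_app K ^^ (k - t0)) g) ((1 - real CARD('a) * \<mu>) ^ ((k - t0) div t0) * d)"
      using less[of "k - t0"] t0 False by auto
    from osc_le_kernel_app[OF stochastic_power[OF K(1)] K(2) this]
    have "osc_le ((kernel_app K ^^ t0) ((kernel_app K ^^ (k - t0)) g)) ((1 - real CARD('a) * \<mu>) ^ (k div t0) * d)"
      by (simp add: kernel_app_power k mult.assoc)
    then show ?thesis using False funpow_add[of t0 "k - t0" "kernel_app K"] by simp
  qed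
qed

text \<open>The exponent is constant on blocks of length \<open>t0\<close>, so shifting the index by
  \<open>t0\<close> multiplies each term by \<open>q\<close>. Comparing the sum with its extension
  by one block gives the geometric series bound without limits.\<close>

lemma sum_power_div_le:
  fixes q :: real
  assumes "0 \<le> q" "q < 1" "t0 \<ge> 1"
  shows "(\<Sum>k<N. q ^ (k div t0)) \<le> real t0 / (1 - q)"
proof -
  let ?S = "\<lambda>N. \<Sum>k<N. q ^ (k div t0)"
  have "?S (N + t0) = (\<Sum>k<t0. q ^ (k div t0)) + (\<Sum>k=t0..<N+t0. q ^ (k div t0))"
    by (subst sum.union_disjoint[symmetric]) (auto intro!: sum.cong)
  also have "(\<Sum>k<t0. q ^ (k div t0)) = real t0" by simp
  also have "(\<Sum>k=t0..<N+t0. q ^ (k div t0)) = (\<Sum>k<N. q ^ ((k + t0) div t0))"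
    using sum.shift_bounds_nat_ivl[of "\<lambda>k. q ^ (k div t0)" 0 t0 N] by (simp add: atLeast0LessThan)
  also have "\<dots> = q * ?S N" using assms by (simp add: sum_distrib_left)
  finally have "?S (N + t0) = real t0 + q * ?S N" .
  moreover have "?S N \<le> ?S (N + t0)" using assms by (intro sum_mono2) auto
  ultimately have "(1 - q) * ?S N \<le> real t0" by (simp add: algebra_simps)
  then show ?thesis using assms by (simp add: field_simps)
qed

section \<open>Expected number of visits and its Laplace transform\<close>

definition expected_visits :: "('a::finite \<Rightarrow> 'a \<Rightarrow> real) \<Rightarrow> 'a \<Rightarrow> nat \<Rightarrow> 'a \<Rightarrow> real" where
  "expected_visits K a n x = (\<Sum>k<n. (kernel_app K ^^ k) (indicator {a}) x)"

text \<open>First-step decomposition; the starting state is the first counted position. It has the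
  same shape as the recursion of \<open>visit_mgf\<close>, so that the two can be compared by
  induction.\<close>

lemma expected_visits_Suc:
  "expected_visits K a (Suc n) x = indicator {a} x + kernel_app K (expected_visits K a n) x"
  unfolding expected_visits_def[abs_def] kernel_app_sum
  by (simp add: sum.lessThan_Suc_shift del: sum.lessThan_Suc)

text \<open>The \<open>k\<close>-th summand oscillates by at most the \<open>k\<close>-th term of
  the series in \<open>sum_power_div_le\<close>, so the bound does not depend on \<open>n\<close>.
  For \<open>\<mu> = \<lambda> / |A|\<close> it is \<open>t0 / \<lambda>\<close>.\<close>

lemma osc_le_expected_visits:
  fixes K :: "'a::finite \<Rightarrow> 'a \<Rightarrow> real"
  assumes K: "stochastic K" "\<And>x y. \<mu> \<le> kernel_power K t0 x y" and t0: "t0 \<ge> 1" and \<mu>: "0 < \<mu>"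
  shows "osc_le (expected_visits K a n) (real t0 / (real CARD('a) * \<mu>))"
proof -
  define q where "q = 1 - real CARD('a) * \<mu>"
  \<comment> \<open>Any row will do: it sums to 1 and dominates \<open>\<mu>\<close> entrywise,
    which puts \<open>q\<close> into \<open>[0, 1)\<close>.\<close>
  have "(\<Sum>y\<in>(UNIV::'a set). \<mu>) \<le> (\<Sum>y\<in>UNIV. kernel_power K t0 (SOME x. True) y)"
    by (intro sum_mono K)
  then have q: "0 \<le> q" "q < 1"
    using \<mu> stochasticD(2)[OF stochastic_power[OF K(1)]] by (auto simp: q_def)
  have "expected_visits K a n x - expected_visits K a n y \<le> real t0 / (real CARD('a) * \<mu>)" for x y
  proof -
    have "osc_le (indicator {a} :: 'a \<Rightarrow> real) 1" by (auto simp: osc_le_def indicator_def)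
    from osc_le_iterate[OF K t0 this]
    have "expected_visits K a n x - expected_visits K a n y \<le> (\<Sum>k<n. q ^ (k div t0))"
      unfolding expected_visits_def sum_subtractf[symmetric] osc_le_def q_def by (intro sum_mono) auto
    with sum_power_div_le[OF q t0, of n] show ?thesis by (simp add: q_def)
  qed
  then show ?thesis by (simp add: osc_le_def)
qed

text \<open>Under the invariant weights \<open>w\<close> the mean of \<open>expected_visits\<close>
  is exactly \<open>n * w a\<close>, and a function falls below its mean by at most its
  oscillation.\<close>

lemma expected_visits_ge:
  fixes K :: "'a::finite \<Rightarrow> 'a \<Rightarrow> real"
  assumes inv: "\<And>y. (\<Sum>x\<in>UNIV. w x * K x y) = w y" and w: "\<And>x. 0 \<le> w x" "(\<Sum>x\<in>UNIV. w x) = 1"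
    and osc: "osc_le (expected_visits K a n) B"
  shows "real n * w a - B \<le> expected_visits K a n x"
proof -
  have "(\<Sum>x\<in>UNIV. w x * (kernel_app K ^^ k) (indicator {a}) x) = w a" for k
    by (induction k) (auto simp: stationary_kernel_app[OF inv])
  then have "(\<Sum>y\<in>UNIV. w y * expected_visits K a n y) = real n * w a"
    unfolding expected_visits_def sum_distrib_left by (subst sum.swap) simp
  moreover have "(\<Sum>y\<in>UNIV. w y * (expected_visits K a n y - expected_visits K a n x)) \<le> (\<Sum>y\<in>UNIV. w y * B)"
    using osc w by (intro sum_mono mult_left_mono) (auto simp: osc_le_def)
  ultimately show ?thesis using w by (simp add: right_diff_distrib sum_subtractf flip: sum_distrib_right)
qed

text \<open>\<open>visit_mgf K a \<theta> n x\<close> is the expectation of \<open>exp (- \<theta> N)\<close>, with \<open>N\<close> the number of visits to \<open>a\<close>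
  among the first \<open>n\<close> positions of the chain started in \<open>x\<close>.\<close>

primrec visit_mgf :: "('a::finite \<Rightarrow> 'a \<Rightarrow> real) \<Rightarrow> 'a \<Rightarrow> real \<Rightarrow> nat \<Rightarrow> 'a \<Rightarrow> real" where
  "visit_mgf K a \<theta> 0 = (\<lambda>x. 1)"
| "visit_mgf K a \<theta> (Suc n) = (\<lambda>x. exp (- \<theta> * indicator {a} x) * kernel_app K (visit_mgf K a \<theta> n) x)"

text \<open>Hoeffding's lemma for one transition: under the row of \<open>x\<close> the values of
  \<open>h\<close> lie in an interval of length \<open>B\<close>.\<close>

lemma kernel_app_exp_le:
  fixes K :: "'a::finite \<Rightarrow> 'a \<Rightarrow> real"
  assumes K: "stochastic K" and h: "osc_le h B" and \<theta>: "\<theta> > 0"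
  shows "kernel_app K (\<lambda>y. exp (- \<theta> * h y)) x \<le> exp (- \<theta> * kernel_app K h x + \<theta>\<^sup>2 * B\<^sup>2 / 8)"
proof -
  define p where "p = embed_pmf (K x)"
  have p: "pmf p y = K x y" for y
    unfolding p_def using stochasticD[OF K, of x]
    by (subst pmf_embed_pmf) (simp_all add: nn_integral_count_space_finite)
  have E: "measure_pmf.expectation p g = kernel_app K g x" for g :: "'a \<Rightarrow> real"
    by (subst integral_measure_pmf_real[of UNIV]) (auto simp: kernel_app_def p mult.commute)
  \<comment> \<open>The interval \<open>[b - B, b]\<close> contains all values of
    \<open>- h\<close>: its right end is attained, and the oscillation bound gives the left
    end.\<close>
  define b where "b = (MAX y. - h y)"
  have "b \<in> range (\<lambda>y. - h y)" unfolding b_def by (intro Max_in) auto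
  then obtain z where "b = - h z" by auto
  moreover have "- h y \<le> b" for y unfolding b_def by (intro Max_ge) auto
  ultimately have b: "- h y \<in> {b - B..b}" for y
    using h[unfolded osc_le_def, rule_format, of y z] by auto
  interpret interval_bounded_random_variable "measure_pmf p" "\<lambda>y. - h y" "b - B" b
    by unfold_locales (use b in auto)
  let ?m = "measure_pmf.expectation p (\<lambda>y. - h y)"
  have "ennreal (measure_pmf.expectation p (\<lambda>y. exp (\<theta> * (- h y - ?m)))) \<le> ennreal (exp (\<theta>\<^sup>2 * B\<^sup>2 / 8))"
    using Hoeffdings_lemma_nn_integral[OF \<theta>]
    by (subst nn_integral_eq_integral[symmetric]) (auto intro!: integrable_measure_pmf_finite)
  then have "measure_pmf.expectation p (\<lambda>y. exp (\<theta> * (- h y - ?m))) \<le> exp (\<theta>\<^sup>2 * B\<^sup>2 / 8)"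
    by (subst (asm) ennreal_le_iff) auto
  also have "measure_pmf.expectation p (\<lambda>y. exp (\<theta> * (- h y - ?m)))
      = exp (\<theta> * kernel_app K h x) * kernel_app K (\<lambda>y. exp (- \<theta> * h y)) x"
    unfolding E by (simp add: kernel_app_def sum_distrib_left sum_negf algebra_simps flip: exp_add)
  \<comment> \<open>Hoeffding's lemma concerns the centred variable; multiplying by
    \<open>exp (- \<theta> * kernel_app K h x)\<close> undoes the centring.\<close>
  finally have "exp (- \<theta> * kernel_app K h x) * (exp (\<theta> * kernel_app K h x) * kernel_app K (\<lambda>y. exp (- \<theta> * h y)) x)
      \<le> exp (- \<theta> * kernel_app K h x) * exp (\<theta>\<^sup>2 * B\<^sup>2 / 8)"
    by (intro mult_left_mono) auto
  then show ?thesis by (simp add: mult.assoc[symmetric] flip: exp_add)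
qed

text \<open>The function \<open>exp (- \<theta> * expected_visits K a n x)\<close> satisfies the
  recursion of \<open>visit_mgf\<close> up to a factor of at most
  \<open>exp (\<theta>\<^sup>2 * B\<^sup>2 / 8)\<close> per step. Since \<open>B\<close> serves
  every number of remaining positions, the \<open>n\<close> factors simply multiply.\<close>

lemma visit_mgf_le:
  fixes K :: "'a::finite \<Rightarrow> 'a \<Rightarrow> real"
  assumes K: "stochastic K" and h: "\<And>n. osc_le (expected_visits K a n) B" and \<theta>: "\<theta> > 0"
  shows "visit_mgf K a \<theta> n x \<le> exp (- \<theta> * expected_visits K a n x + real n * (\<theta>\<^sup>2 * B\<^sup>2 / 8))"
proof (induction n arbitrary: x)
  case 0
  show ?case by (simp add: expected_visits_def)
next
  case (Suc n)
  let ?c = "real n * (\<theta>\<^sup>2 * B\<^sup>2 / 8)" and ?h = "expected_visits K a n"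
  have "kernel_app K (visit_mgf K a \<theta> n) x \<le> kernel_app K (\<lambda>y. exp ?c * exp (- \<theta> * ?h y)) x"
    using Suc by (intro kernel_app_mono[OF K]) (simp flip: exp_add add: add.commute)
  also have "\<dots> = exp ?c * kernel_app K (\<lambda>y. exp (- \<theta> * ?h y)) x"
    by (simp add: kernel_app_def sum_distrib_left mult.left_commute)
  also have "\<dots> \<le> exp ?c * exp (- \<theta> * kernel_app K ?h x + \<theta>\<^sup>2 * B\<^sup>2 / 8)"
    by (intro mult_left_mono kernel_app_exp_le K h \<theta>) auto
  finally have "visit_mgf K a \<theta> (Suc n) x \<le> exp (- \<theta> * indicator {a} x) * (exp ?c * exp (- \<theta> * kernel_app K ?h x + \<theta>\<^sup>2 * B\<^sup>2 / 8))"
    by simp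
  also have "\<dots> = exp (- \<theta> * expected_visits K a (Suc n) x + real (Suc n) * (\<theta>\<^sup>2 * B\<^sup>2 / 8))"
    by (simp add: expected_visits_Suc algebra_simps flip: exp_add)
  finally show ?case .
qed

section \<open>Trajectories and time reversal\<close>

lemma stochastic_trans_mat: "stochastic (trans_mat (Q :: 'a::finite \<Rightarrow> 'a pmf))"
  by (simp add: stochastic_def sum_pmf_eq_1)

lemma pmf_bind_finite:
  fixes p :: "'a::finite pmf"
  shows "pmf (bind_pmf p f) y = (\<Sum>x\<in>UNIV. pmf p x * pmf (f x) y)"
  unfolding pmf_bind by (subst integral_measure_pmf_real[of UNIV]) (auto simp: mult.commute)

lemma stationary_sum:
  fixes \<pi> :: "'a::finite pmf"
  shows "stationary Q \<pi> \<Longrightarrow> (\<Sum>x\<in>UNIV. pmf \<pi> x * pmf (Q x) y) = pmf \<pi> y"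
  by (simp add: stationary_def flip: pmf_bind_finite)

lemma stochastic_reversed_kernel:
  fixes \<pi> :: "'a::finite pmf"
  assumes "stationary Q \<pi>" "\<And>x. 0 < pmf \<pi> x"
  shows "stochastic (reversed_kernel Q \<pi>)"
  using assms(2) unfolding stochastic_def reversed_kernel_def
  by (auto simp: stationary_sum[OF assms(1)] less_imp_neq[THEN not_sym] simp flip: sum_divide_distrib)

lemma stationary_reversed_kernel:
  fixes \<pi> :: "'a::finite pmf"
  assumes "\<And>x. 0 < pmf \<pi> x"
  shows "(\<Sum>x\<in>UNIV. pmf \<pi> x * reversed_kernel Q \<pi> x y) = pmf \<pi> y"
proof -
  have "(\<Sum>x\<in>UNIV. pmf \<pi> x * reversed_kernel Q \<pi> x y) = (\<Sum>x\<in>UNIV. pmf \<pi> y * pmf (Q y) x)"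
    using assms by (intro sum.cong) (auto simp: reversed_kernel_def less_imp_neq[THEN not_sym])
  then show ?thesis by (simp add: sum_pmf_eq_1 flip: sum_distrib_left)
qed

text \<open>In the induction step the weights of the intermediate state cancel, which leaves a power
  of \<open>Q\<close> with its last step split off. The formula makes the powers of the reversed
  kernel positive along with those of \<open>Q\<close>.\<close>

lemma kernel_power_reversed:
  fixes \<pi> :: "'a::finite pmf"
  assumes "\<And>x. 0 < pmf \<pi> x"
  shows "kernel_power (reversed_kernel Q \<pi>) t x y = pmf \<pi> y * kernel_power (trans_mat Q) t y x / pmf \<pi> x"
proof (induction t arbitrary: x)
  case 0
  show ?case using assms[of x] by auto
next
  case (Suc t)
  have "kernel_power (reversed_kernel Q \<pi>) (Suc t) x y
      = (\<Sum>z\<in>UNIV. kernel_power (trans_mat Q) t y z * pmf (Q z) x) * pmf \<pi> y / pmf \<pi> x"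
    unfolding kernel_power.simps Suc sum_distrib_right sum_divide_distrib reversed_kernel_def
    using assms by (intro sum.cong) (auto simp: less_imp_neq[THEN not_sym])
  also have "\<dots> = pmf \<pi> y * kernel_power (trans_mat Q) (Suc t) y x / pmf \<pi> x"
    using kernel_power_commute[of "trans_mat Q" t y x] by simp
  finally show ?case .
qed

section \<open>Distributions of trajectories\<close>

text \<open>Trajectories are stored latest state first, so that \<^term>\<open>hd\<close> is the state at time \<open>n + 1\<close>.\<close>

primrec path_pmf :: "'s pmf \<Rightarrow> ('s \<Rightarrow> 's pmf) \<Rightarrow> nat \<Rightarrow> 's list pmf" where
  "path_pmf \<eta> Q 0 = map_pmf (\<lambda>x. [x]) \<eta>"
| "path_pmf \<eta> Q (Suc n) = bind_pmf (path_pmf \<eta> Q n) (\<lambda>xs. map_pmf (\<lambda>x. x # xs) (Q (hd xs)))"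

lemma length_path_pmf: "xs \<in> set_pmf (path_pmf \<eta> Q n) \<Longrightarrow> length xs = Suc n"
  by (induction n arbitrary: xs) auto

lemma finite_path_pmf: "finite (set_pmf (path_pmf \<eta> (Q :: 'a::finite \<Rightarrow> 'a pmf) n))"
  by (induction n) auto

lemma map_tl_path_pmf: "map_pmf tl (path_pmf \<eta> Q (Suc n)) = path_pmf \<eta> Q n"
  by (simp add: map_bind_pmf pmf.map_comp comp_def bind_return_pmf')

lemma expectation_path_pmf_Suc:
  fixes Q :: "'a::finite \<Rightarrow> 'a pmf" and g :: "'a list \<Rightarrow> real"
  shows "measure_pmf.expectation (path_pmf \<eta> Q (Suc n)) g
    = measure_pmf.expectation (path_pmf \<eta> Q n) (\<lambda>xs. \<Sum>x\<in>UNIV. pmf (Q (hd xs)) x * g (x # xs))"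
proof -
  have *: "measure_pmf.expectation (Q (hd xs)) (\<lambda>x. g (x # xs)) = (\<Sum>x\<in>UNIV. pmf (Q (hd xs)) x * g (x # xs))"
    for xs by (subst integral_measure_pmf[of UNIV]) auto
  show ?thesis unfolding path_pmf.simps
    by (subst pmf_expectation_bind[OF finite_path_pmf _ order.refl])
      (simp_all add: * integral_measure_pmf[OF finite_path_pmf])
qed

lemma exp_count_list_Cons:
  "exp (- \<theta> * real (count_list (x # xs) a)) = exp (- \<theta> * indicator {a} x) * exp (- \<theta> * real (count_list xs a))"
  by (auto simp: indicator_def algebra_simps simp flip: exp_add)

text \<open>The trajectory has \<open>n + 1\<close> states, and the factor \<open>kernel_app\<close>
  averages over \<open>m\<close> further positions. Keeping \<open>m\<close> general lets the
  induction move the latest state into the averaged part; the case of interest is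
  \<open>m = 0\<close>.\<close>

lemma expectation_path_visits:
  fixes Q :: "'a::finite \<Rightarrow> 'a pmf"
  shows "measure_pmf.expectation (path_pmf \<eta> Q n)
      (\<lambda>xs. exp (- \<theta> * real (count_list xs a)) * kernel_app (trans_mat Q) (visit_mgf (trans_mat Q) a \<theta> m) (hd xs))
    = (\<Sum>x\<in>UNIV. pmf \<eta> x * visit_mgf (trans_mat Q) a \<theta> (Suc (m + n)) x)"
proof (induction n arbitrary: m)
  case 0
  show ?case by (simp, subst integral_measure_pmf[of UNIV]) (auto intro!: sum.cong simp: indicator_def)
next
  case (Suc n)
  have "(\<Sum>x\<in>UNIV. pmf (Q (hd xs)) x * (exp (- \<theta> * real (count_list (x # xs) a)) *
      kernel_app (trans_mat Q) (visit_mgf (trans_mat Q) a \<theta> m) (hd (x # xs))))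
    = exp (- \<theta> * real (count_list xs a)) *
      kernel_app (trans_mat Q) (visit_mgf (trans_mat Q) a \<theta> (Suc m)) (hd xs)" for xs
    unfolding kernel_app_def[of _ "visit_mgf (trans_mat Q) a \<theta> (Suc m)"] sum_distrib_left
    unfolding exp_count_list_Cons by (intro sum.cong refl) simp
  then show ?case unfolding expectation_path_pmf_Suc using Suc[of "Suc m"] by simp
qed

text \<open>Time reversal: under the stationary law and given the latest state \<open>x\<close>, the
  earlier states read backwards form a chain with kernel \<open>K\<close> whose first state is drawn
  from the row of \<open>x\<close>. Each step is turned around by
  \<open>\<pi>\<^sub>y Q(y,x) = \<pi>\<^sub>x K(x,y)\<close>.\<close>

lemma expectation_path_visits_rev:
  fixes Q :: "'a::finite \<Rightarrow> 'a pmf"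
  assumes pos: "\<And>x. 0 < pmf \<pi> x" and st: "stationary Q \<pi>"
  defines "K \<equiv> reversed_kernel Q \<pi>"
  shows "measure_pmf.expectation (path_pmf \<pi> Q n)
      (\<lambda>xs. of_bool (hd xs = x) * exp (- \<theta> * real (count_list (tl xs) a)))
    = pmf \<pi> x * kernel_app K (visit_mgf K a \<theta> n) x"
proof (induction n arbitrary: x)
  case 0
  have "stochastic K" unfolding K_def by (intro stochastic_reversed_kernel st pos)
  then show ?case
    by (simp add: kernel_app_const, subst integral_measure_pmf[of UNIV]) (auto simp: of_bool_def mult_delta_left mult_delta_right)
next
  case (Suc n)
  let ?E = "measure_pmf.expectation (path_pmf \<pi> Q n)"
  let ?t = "\<lambda>xs y. pmf (Q y) x * exp (- \<theta> * indicator {a} y) *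
        (of_bool (hd xs = y) * exp (- \<theta> * real (count_list (tl xs) a)))"
  have nz: "pmf \<pi> y \<noteq> 0" for y using pos[of y] by simp
  \<comment> \<open>Splitting by the value \<open>y\<close> of the previous state produces the
    integrand of the induction hypothesis. In each sum only one term can be nonzero:
    \<open>y = x\<close> on the left, \<open>y = hd xs\<close> on the right.\<close>
  have step: "(\<Sum>y\<in>UNIV. pmf (Q (hd xs)) y * (of_bool (hd (y # xs) = x) * exp (- \<theta> * real (count_list (tl (y # xs)) a))))
    = (\<Sum>y\<in>UNIV. ?t xs y)" (is "?l = ?r")
    if xs: "xs \<in> set_pmf (path_pmf \<pi> Q n)" for xs
  proof -
    obtain z zs where z: "xs = z # zs" using length_path_pmf[OF xs] by (cases xs) auto
    have "?l = pmf (Q z) x * exp (- \<theta> * real (count_list (z # zs) a))"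
      unfolding z list.sel by (subst sum.remove[of _ x]) (simp_all del: count_list.simps)
    moreover have "?r = pmf (Q z) x * (exp (- \<theta> * indicator {a} z) * exp (- \<theta> * real (count_list zs a)))"
      unfolding z list.sel by (subst sum.remove[of _ z]) (simp_all del: count_list.simps)
    ultimately show ?thesis by (simp only: exp_count_list_Cons)
  qed
  have "measure_pmf.expectation (path_pmf \<pi> Q (Suc n))
      (\<lambda>xs. of_bool (hd xs = x) * exp (- \<theta> * real (count_list (tl xs) a))) = ?E (\<lambda>xs. \<Sum>y\<in>UNIV. ?t xs y)"
    unfolding expectation_path_pmf_Suc
    by (rule integral_cong_AE) (simp, simp, subst AE_measure_pmf_iff, blast intro: step)
  also have "\<dots> = (\<Sum>y\<in>UNIV. ?E (\<lambda>xs. ?t xs y))"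
    by (intro Bochner_Integration.integral_sum integrable_measure_pmf_finite finite_path_pmf)
  also have "\<dots> = (\<Sum>y\<in>UNIV. pmf (Q y) x * exp (- \<theta> * indicator {a} y) *
      (pmf \<pi> y * kernel_app K (visit_mgf K a \<theta> n) y))"
    by (simp only: integral_mult_right_zero Suc)
  also have "\<dots> = pmf \<pi> x * kernel_app K (visit_mgf K a \<theta> (Suc n)) x"
    unfolding kernel_app_def[of K "visit_mgf K a \<theta> (Suc n)"] sum_distrib_left
    by (intro sum.cong) (simp_all add: K_def reversed_kernel_def nz)
  finally show ?case .
qed

text \<open>Both chains use the same transitions, so a bound on the density of \<open>\<eta>\<close>
  relative to \<open>\<pi>\<close> persists along the whole trajectory.\<close>

lemma expectation_path_change_init:
  fixes Q :: "'a::finite \<Rightarrow> 'a pmf" and g :: "'a list \<Rightarrow> real"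
  assumes c: "\<And>x. pmf \<eta> x \<le> c * pmf \<pi> x" and g: "\<And>xs. 0 \<le> g xs"
  shows "measure_pmf.expectation (path_pmf \<eta> Q n) g \<le> c * measure_pmf.expectation (path_pmf \<pi> Q n) g"
  using g
proof (induction n arbitrary: g)
  case 0
  have "measure_pmf.expectation (path_pmf p Q 0) g = (\<Sum>x\<in>UNIV. pmf p x * g [x])" for p
    by (simp, subst integral_measure_pmf[of UNIV]) auto
  then show ?case using mult_right_mono[OF c 0] by (auto simp: sum_distrib_left mult.assoc intro!: sum_mono)
next
  case (Suc n)
  show ?case unfolding expectation_path_pmf_Suc by (intro Suc.IH sum_nonneg mult_nonneg_nonneg Suc.prems) auto
qed

section \<open>Lower tail of the number of visits\<close>

text \<open>From any starting state the expected number of visits is at least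
  \<open>n * v - B\<close>, and \<open>D\<close> is the distance from there down to the threshold
  \<open>u\<close>. The left-hand side is the exponential Markov bound for having at most
  \<open>u\<close> visits.\<close>

lemma visit_chernoff:
  fixes K :: "'a::finite \<Rightarrow> 'a \<Rightarrow> real"
  assumes K: "stochastic K" and h: "\<And>n. osc_le (expected_visits K a n) B"
    and inv: "\<And>y. (\<Sum>x\<in>UNIV. w x * K x y) = w y" and w: "\<And>x. 0 \<le> w x" "(\<Sum>x\<in>UNIV. w x) = 1" "v \<le> w a"
    and B: "B > 0" and n: "n \<ge> 1" and D: "0 < D" "D = real n * v - u - B"
    and \<theta>: "\<theta> = 4 * D / (real n * B\<^sup>2)"
  shows "exp (\<theta> * u) * visit_mgf K a \<theta> n x \<le> exp (- 2 * D\<^sup>2 / (real n * B\<^sup>2))"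
proof -
  have \<theta>0: "\<theta> > 0" using D B n by (simp add: \<theta>)
  have "visit_mgf K a \<theta> n x \<le> exp (- \<theta> * expected_visits K a n x + real n * (\<theta>\<^sup>2 * B\<^sup>2 / 8))"
    by (rule visit_mgf_le[OF K h \<theta>0])
  from mult_left_mono[OF this, of "exp (\<theta> * u)"]
  have "exp (\<theta> * u) * visit_mgf K a \<theta> n x \<le> exp (\<theta> * u - \<theta> * expected_visits K a n x + real n * (\<theta>\<^sup>2 * B\<^sup>2 / 8))"
    by (simp add: algebra_simps flip: exp_add)
  also have "\<dots> \<le> exp (- \<theta> * D + real n * (\<theta>\<^sup>2 * B\<^sup>2 / 8))"
  proof -
    have "D \<le> expected_visits K a n x - u"
      using expected_visits_ge[OF inv w(1,2) h, of n x] mult_left_mono[OF w(3), of "real n"] D by auto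
    then have "\<theta> * D \<le> \<theta> * (expected_visits K a n x - u)" using \<theta>0 by (intro mult_left_mono) auto
    then show ?thesis by (simp add: algebra_simps)
  qed
  \<comment> \<open>The choice of \<open>\<theta>\<close> minimises this quadratic.\<close>
  also have "- \<theta> * D + real n * (\<theta>\<^sup>2 * B\<^sup>2 / 8) = - 2 * D\<^sup>2 / (real n * B\<^sup>2)"
    using B n by (simp add: \<theta> field_simps power2_eq_square)
  finally show ?thesis .
qed

lemma mixing_const_entry_le:
  fixes Q :: "'a::finite \<Rightarrow> 'a pmf"
  shows "mixing_const Q \<pi> t0 / real CARD('a) \<le> kernel_power (trans_mat Q) t0 x y"
    and "mixing_const Q \<pi> t0 / real CARD('a) \<le> kernel_power (reversed_kernel Q \<pi>) t0 x y"
proof -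
  have min_le: "(MIN a. MIN b. g a b) \<le> g x y" for g :: "'a \<Rightarrow> 'a \<Rightarrow> real"
  proof -
    have "(MIN a. MIN b. g a b) \<le> (MIN b. g x b)" by (intro Min_le) auto
    also have "\<dots> \<le> g x y" by (intro Min_le) auto
    finally show ?thesis .
  qed
  show "mixing_const Q \<pi> t0 / real CARD('a) \<le> kernel_power (trans_mat Q) t0 x y"
    "mixing_const Q \<pi> t0 / real CARD('a) \<le> kernel_power (reversed_kernel Q \<pi>) t0 x y"
    using min_le[of "kernel_power (trans_mat Q) t0"] min_le[of "kernel_power (reversed_kernel Q \<pi>) t0"]
    by (auto simp: mixing_const_def)
qed

lemma mixing_const_le_1:
  fixes Q :: "'a::finite \<Rightarrow> 'a pmf"
  shows "mixing_const Q \<pi> t0 \<le> 1"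
proof -
  have "(\<Sum>y\<in>(UNIV::'a set). mixing_const Q \<pi> t0 / real CARD('a)) \<le> (\<Sum>y\<in>UNIV. kernel_power (trans_mat Q) t0 undefined y)"
    by (intro sum_mono mixing_const_entry_le)
  then show ?thesis by (simp add: stochasticD[OF stochastic_power[OF stochastic_trans_mat]])
qed

lemma mixing_const_pos:
  fixes Q :: "'a::finite \<Rightarrow> 'a pmf"
  assumes "\<And>a b. kernel_power (trans_mat Q) t0 a b > 0" "\<And>x. 0 < pmf \<pi> x"
  shows "0 < mixing_const Q \<pi> t0"
  using assms by (simp add: mixing_const_def kernel_power_reversed)

lemma visits_le_tail:
  fixes Q :: "'a::finite \<Rightarrow> 'a pmf" and \<pi> \<eta> :: "'a pmf"
  assumes st: "stationary Q \<pi>" and t0: "t0 \<ge> 1" "\<And>a b. kernel_power (trans_mat Q) t0 a b > 0"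
    and pos: "0 < pi_min \<pi>" and n: "n \<ge> 1"
    and B: "B = real t0 / mixing_const Q \<pi> t0" and D: "D = real n * pi_min \<pi> - u - B" "0 < D"
  shows "measure_pmf.prob (path_pmf \<eta> Q n) {xs. real (count_list (tl xs) (hd xs)) \<le> u}
    \<le> init_const \<eta> \<pi> * exp (- 2 * D\<^sup>2 / (real n * B\<^sup>2))"
proof -
  let ?K = "trans_mat Q" and ?R = "reversed_kernel Q \<pi>"
  define \<mu> where "\<mu> = mixing_const Q \<pi> t0 / real CARD('a)"
  define \<theta> where "\<theta> = 4 * D / (real n * B\<^sup>2)"
  let ?e = "exp (- 2 * D\<^sup>2 / (real n * B\<^sup>2))" and ?S = "{xs. real (count_list (tl xs) (hd xs)) \<le> u}"
  have ge: "pi_min \<pi> \<le> pmf \<pi> x" for x by (simp add: pi_min_def)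
  then have \<pi>: "0 < pmf \<pi> x" for x using pos less_le_trans by blast
  have \<mu>: "0 < \<mu>" "\<mu> \<le> kernel_power ?K t0 x y" "\<mu> \<le> kernel_power ?R t0 x y" for x y
    using mixing_const_pos[OF t0(2) \<pi>] by (simp_all add: \<mu>_def mixing_const_entry_le)
  have B': "B = real t0 / (real CARD('a) * \<mu>)" by (simp add: B \<mu>_def)
  have B0: "B > 0" using \<mu>(1) t0(1) by (simp add: B')
  note K = stochastic_trans_mat[of Q] and R = stochastic_reversed_kernel[OF st \<pi>]
  have \<pi>1: "(\<Sum>x\<in>UNIV. pmf \<pi> x) = 1" by (simp add: sum_pmf_eq_1)
  have cK: "exp (\<theta> * u) * visit_mgf ?K a \<theta> n x \<le> ?e" for a x
    unfolding B' by (rule visit_chernoff[OF K osc_le_expected_visits[OF K \<mu>(2) t0(1) \<mu>(1)]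
          stationary_sum[OF st] _ \<pi>1 ge _ n D(2)]) (use B0 D \<theta>_def in \<open>auto simp: B'\<close>)
  have cR: "exp (\<theta> * u) * visit_mgf ?R a \<theta> n x \<le> ?e" for a x
    unfolding B' by (rule visit_chernoff[OF R osc_le_expected_visits[OF R \<mu>(3) t0(1) \<mu>(1)]
          stationary_reversed_kernel[OF \<pi>] _ \<pi>1 ge _ n D(2)]) (use B0 D \<theta>_def in \<open>auto simp: B'\<close>)
  have \<theta>: "0 \<le> \<theta>" using D B0 by (simp add: \<theta>_def)
  have ind: "indicator {xs. real (c xs) \<le> u} xs \<le> exp (\<theta> * u) * exp (- \<theta> * real (c xs))"
    for c :: "'a list \<Rightarrow> nat" and xs
    using mult_left_mono[of "real (c xs)" u \<theta>] \<theta> by (auto simp: indicator_def simp flip: exp_add)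
  note int = integrable_measure_pmf_finite[OF finite_path_pmf]
  \<comment> \<open>The \<open>n\<close> states before the latest one form a trajectory of
    \<open>path_pmf\<close> with index \<open>n - 1\<close>.\<close>
  obtain m where m: "n = Suc m" using n by (cases n) auto

  \<comment> \<open>First term of the minimum in \<open>init_const\<close>: the random state
    \<open>hd xs\<close> is replaced by a fixed \<open>a\<close>, at the cost of a sum over the
    alphabet.\<close>
  have "measure_pmf.prob (path_pmf \<eta> Q n) ?S \<le> measure_pmf.prob (path_pmf \<eta> Q n) (\<Union>a. {xs. real (count_list (tl xs) a) \<le> u})"
    by (intro measure_pmf.finite_measure_mono) auto
  also have "\<dots> \<le> (\<Sum>a\<in>UNIV. measure_pmf.prob (path_pmf \<eta> Q n) {xs. real (count_list (tl xs) a) \<le> u})"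
    by (rule measure_pmf.finite_measure_subadditive_finite) auto
  also have "\<dots> \<le> (\<Sum>a\<in>(UNIV::'a set). ?e)"
  proof (intro sum_mono)
    fix a
    have "measure_pmf.prob (path_pmf \<eta> Q n) {xs. real (count_list (tl xs) a) \<le> u}
        = measure_pmf.prob (path_pmf \<eta> Q m) {xs. real (count_list xs a) \<le> u}"
      using measure_map_pmf[of tl "path_pmf \<eta> Q n" "{xs. real (count_list xs a) \<le> u}"]
      unfolding m map_tl_path_pmf by (simp only: vimage_Collect_eq)
    also have "\<dots> = measure_pmf.expectation (path_pmf \<eta> Q m) (indicator {xs. real (count_list xs a) \<le> u})"
      by simp
    also have "\<dots> \<le> measure_pmf.expectation (path_pmf \<eta> Q m) (\<lambda>xs. exp (\<theta> * u) * exp (- \<theta> * real (count_list xs a)))"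
      by (intro integral_mono int ind)
    also have "\<dots> = exp (\<theta> * u) * (\<Sum>x\<in>UNIV. pmf \<eta> x * visit_mgf ?K a \<theta> n x)"
      using expectation_path_visits[of \<eta> Q m \<theta> a 0] by (simp add: kernel_app_const[OF K] m)
    also have "\<dots> \<le> (\<Sum>x\<in>UNIV. pmf \<eta> x * ?e)"
      unfolding sum_distrib_left using cK by (intro sum_mono) (simp add: mult.left_commute mult_left_mono)
    finally show "measure_pmf.prob (path_pmf \<eta> Q n) {xs. real (count_list (tl xs) a) \<le> u} \<le> ?e"
      by (simp add: sum_pmf_eq_1 flip: sum_distrib_right)
  qed
  finally have 1: "measure_pmf.prob (path_pmf \<eta> Q n) ?S \<le> real CARD('a) * ?e" by simp

  \<comment> \<open>Second term of the minimum: \<open>c\<close> bounds the density of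
    \<open>\<eta>\<close> relative to \<open>\<pi>\<close>, so one can pass to the stationary chain
    and reverse it.\<close>
  define c where "c = (MAX a. pmf \<eta> a / pmf \<pi> a)"
  have "pmf \<eta> x / pmf \<pi> x \<le> c" for x unfolding c_def by (intro Max_ge) auto
  then have c: "pmf \<eta> x \<le> c * pmf \<pi> x" for x using \<pi> by (simp add: pos_divide_le_eq)
  have c0: "0 \<le> c"
  proof -
    have "0 \<le> c * pmf \<pi> undefined" using c[of undefined] pmf_nonneg[of \<eta> undefined] by linarith
    then show ?thesis using \<pi>[of undefined] by (simp add: zero_le_mult_iff)
  qed
  have "measure_pmf.prob (path_pmf \<eta> Q n) ?S = measure_pmf.expectation (path_pmf \<eta> Q n) (indicator ?S)" by simp
  also have "\<dots> \<le> c * measure_pmf.expectation (path_pmf \<pi> Q n) (indicator ?S)"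
    by (intro expectation_path_change_init c) auto
  also have "\<dots> \<le> c * measure_pmf.expectation (path_pmf \<pi> Q n)
      (\<lambda>xs. \<Sum>a\<in>UNIV. exp (\<theta> * u) * (of_bool (hd xs = a) * exp (- \<theta> * real (count_list (tl xs) a))))"
  proof (intro mult_left_mono integral_mono int c0)
    fix xs :: "'a list"
    show "indicator ?S xs \<le> (\<Sum>a\<in>UNIV. exp (\<theta> * u) * (of_bool (hd xs = a) * exp (- \<theta> * real (count_list (tl xs) a))))"
      using ind[of "\<lambda>xs. count_list (tl xs) (hd xs)" xs] by (subst sum.remove[of _ "hd xs"]) auto
  qed
  also have "\<dots> = c * (\<Sum>a\<in>UNIV. exp (\<theta> * u) * (pmf \<pi> a * kernel_app ?R (visit_mgf ?R a \<theta> n) a))"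
    by (simp only: Bochner_Integration.integral_sum integral_mult_right_zero expectation_path_visits_rev[OF \<pi> st] int)
  also have "\<dots> \<le> c * (\<Sum>a\<in>UNIV. pmf \<pi> a * ?e)"
  proof (intro mult_left_mono sum_mono c0)
    fix a
    \<comment> \<open>The reversed chain makes one step from \<open>a\<close> before its
      \<open>n\<close> counted positions; the Chernoff bound is uniform in the starting state and
      survives this averaging.\<close>
    have "exp (\<theta> * u) * kernel_app ?R (visit_mgf ?R a \<theta> n) a = kernel_app ?R (\<lambda>x. exp (\<theta> * u) * visit_mgf ?R a \<theta> n x) a"
      by (simp add: kernel_app_def sum_distrib_left mult.left_commute)
    also have "\<dots> \<le> kernel_app ?R (\<lambda>_. ?e) a" by (intro kernel_app_mono R cR)
    also have "\<dots> = ?e" by (rule kernel_app_const[OF R])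
    finally show "exp (\<theta> * u) * (pmf \<pi> a * kernel_app ?R (visit_mgf ?R a \<theta> n) a) \<le> pmf \<pi> a * ?e"
      by (simp add: mult.left_commute mult_left_mono)
  qed
  finally have 2: "measure_pmf.prob (path_pmf \<eta> Q n) ?S \<le> c * ?e"
    by (simp add: \<pi>1 flip: sum_distrib_right)
  from 1 2 show ?thesis by (simp add: init_const_def c_def min_def)
qed

section \<open>Match probability of a single letter distribution\<close>

text \<open>The total mass 1 leaves room for at most \<open>1 / x\<close> such letters. Finiteness
  matters because \<open>card\<close> is 0 on infinite sets.\<close>

lemma finite_pmf_ge:
  assumes "0 < x"
  shows "finite {k. x \<le> pmf p k}"
proof -
  have "ennreal x * emeasure (count_space UNIV) {k. x \<le> pmf p k}
      = (\<integral>\<^sup>+k. ennreal x * indicator {k. x \<le> pmf p k} k \<partial>count_space UNIV)"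
    by (simp add: nn_integral_cmult)
  also have "\<dots> \<le> (\<integral>\<^sup>+k. ennreal (pmf p k) \<partial>count_space UNIV)"
    by (intro nn_integral_mono) (auto simp: indicator_def intro: ennreal_leI)
  also have "\<dots> = 1" by (rule nn_integral_pmf_eq_1)
  finally have "ennreal x * emeasure (count_space UNIV) {k. x \<le> pmf p k} < \<top>"
    by (metis ennreal_one_less_top le_less_trans)
  then show ?thesis
    using assms by (auto simp: ennreal_mult_less_top emeasure_count_space split: if_splits)
qed

lemma pmf_ge_eq:
  assumes "set_pmf p \<subseteq> {1::nat..}" "0 < u"
  shows "{k. u \<le> pmf p k} = {k. k \<ge> 1 \<and> u \<le> pmf p k}"
proof -
  have "0 \<notin> set_pmf p" using assms(1) by auto
  then have "pmf p 0 = 0" by (simp add: set_pmf_iff)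
  then have "k \<ge> 1" if "u \<le> pmf p k" for k using that assms(2) by (cases k) auto
  then show ?thesis by auto
qed

text \<open>The left-hand side is the probability that a \<open>p\<close>-coin shows \<open>r\<close> heads in \<open>m\<close> tosses, followed by
  another head; for \<open>r > 0\<close> it is \<open>(r + 1) / (m + 1)\<close> times a binomial probability.\<close>

lemma mult_binomial_le:
  fixes p :: real
  assumes p: "0 \<le> p" "p \<le> 1" and m: "r < m"
  shows "p * (real (m choose r) * p ^ r * (1 - p) ^ (m - r)) \<le> c0 r / real m"
proof (cases "r = 0")
  case True
  have "(1 - p) ^ m \<le> exp (- p) ^ m"
    using p exp_ge_add_one_self[of "- p"] by (intro power_mono) auto
  then have "real m * p * (1 - p) ^ m \<le> real m * p * exp (- (real m * p))"
    using p by (intro mult_left_mono) (auto simp: exp_of_nat_mult[symmetric])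
  \<comment> \<open>The inequality \<open>z \<le> exp (z - 1)\<close> at \<open>z = m * p\<close>;
    it bounds \<open>z * exp (- z)\<close> by its maximum \<open>exp (- 1)\<close>, which is
    \<open>c0 0\<close>.\<close>
  also have "\<dots> \<le> exp (real m * p - 1) * exp (- (real m * p))"
    using exp_ge_add_one_self[of "real m * p - 1"] by (intro mult_right_mono) auto
  also have "\<dots> = exp (- 1)" by (simp flip: exp_add)
  finally show ?thesis using m True by (simp add: c0_def field_simps)
next
  case False
  let ?b = "real (Suc m choose Suc r) * p ^ Suc r * (1 - p) ^ (m - r)"
  have "?b = pmf (binomial_pmf (Suc m) p) (Suc r)" using p by simp
  then have b: "0 \<le> ?b" "?b \<le> 1" by (simp_all add: pmf_le_1 del: pmf_binomial)
  have "real (Suc m) * (p * (real (m choose r) * p ^ r * (1 - p) ^ (m - r)))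
      = real (Suc m * (m choose r)) * (p ^ Suc r * (1 - p) ^ (m - r))"
    by (simp only: of_nat_mult power_Suc mult_ac)
  also have "\<dots> = real (Suc r) * ?b"
    by (simp only: Suc_times_binomial_eq) (simp only: of_nat_mult mult_ac)
  also have "\<dots> \<le> real (Suc r)" using b mult_left_mono[of ?b 1 "real (Suc r)"] by simp
  finally have "real (Suc m) * (p * (real (m choose r) * p ^ r * (1 - p) ^ (m - r))) \<le> real (Suc r)" .
  moreover have "real m * (p * (real (m choose r) * p ^ r * (1 - p) ^ (m - r))) \<le> real (Suc m) * (p * (real (m choose r) * p ^ r * (1 - p) ^ (m - r)))"
    using p by (intro mult_right_mono mult_nonneg_nonneg) auto
  ultimately have "real m * (p * (real (m choose r) * p ^ r * (1 - p) ^ (m - r))) \<le> real (Suc r)" by (rule order.trans[rotated])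
  \<comment> \<open>Bounding the binomial probability by 1 leaves \<open>r + 1\<close>, and this is
    at most \<open>c0 r\<close> because \<open>sqrt pi \<le> 2 \<le> exp 1\<close>.\<close>
  also have "real (Suc r) \<le> c0 r"
  proof -
    have "sqrt pi \<le> sqrt 4" using pi_less_4 by (intro real_sqrt_le_mono) simp
    also have "\<dots> \<le> exp 1" using exp_ge_add_one_self[of 1] by simp
    finally have "sqrt pi * (1 + real r) \<le> exp 1 * (1 + real r)" by (intro mult_right_mono) auto
    then show ?thesis using False by (simp add: c0_def pos_le_divide_eq mult.commute)
  qed
  finally show ?thesis using m by (simp add: field_simps)
qed

text \<open>Scaling by \<open>2 * y\<close> carries the interval from 0 to \<open>1 / 2\<close> onto
  the one from 0 to \<open>y\<close>, and \<open>exp (- u) \<ge> 1 / 2\<close> on the former gives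
  the factor 2. Extended values include the case \<open>t = 0\<close>, where both sides are
  infinite.\<close>

lemma lower_gamma_ge:
  fixes y t :: real
  assumes y: "0 < y"
  shows "(\<integral>\<^sup>+u. ennreal (u powr (t - 1)) * indicator {0<..<y} u \<partial>lborel) \<le> ennreal (2 * (2 * y) powr t) * lower_gamma t (1 / 2)"
proof -
  have "(\<integral>\<^sup>+u. ennreal (u powr (t - 1)) * indicator {0<..<y} u \<partial>lborel)
    = ennreal (2 * y) * (\<integral>\<^sup>+u. ennreal ((2 * y * u) powr (t - 1)) * indicator {0<..<y} (2 * y * u) \<partial>lborel)"
    using nn_integral_real_affine[of "\<lambda>u. ennreal (u powr (t - 1)) * indicator {0<..<y} u" "2 * y" 0] y by simp
  also have "\<dots> \<le> ennreal (2 * y) * (\<integral>\<^sup>+u. ennreal (2 * (2 * y) powr (t - 1)) *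
      (ennreal (u powr (t - 1) * exp (- u)) * indicator {0<..<1 / 2} u) \<partial>lborel)"
  proof (intro mult_left_mono nn_integral_mono)
    fix u :: real
    show "ennreal ((2 * y * u) powr (t - 1)) * indicator {0<..<y} (2 * y * u) \<le> ennreal (2 * (2 * y) powr (t - 1)) *
      (ennreal (u powr (t - 1) * exp (- u)) * indicator {0<..<1 / 2} u)"
    proof (cases "0 < u \<and> u < 1 / 2")
      case True
      then have "1 \<le> 2 * exp (- u)" using exp_ge_add_one_self[of "- u"] by linarith
      then have "(2 * y) powr (t - 1) * u powr (t - 1) * 1 \<le> (2 * y) powr (t - 1) * u powr (t - 1) * (2 * exp (- u))"
        by (intro mult_left_mono) auto
      then have "(2 * y * u) powr (t - 1) \<le> 2 * (2 * y) powr (t - 1) * (u powr (t - 1) * exp (- u))"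
        using True y by (simp add: powr_mult)
      then show ?thesis using True by (auto simp: indicator_def simp flip: ennreal_mult intro: ennreal_leI)
    next
      case False
      then have "2 * y * u \<notin> {0<..<y}" using y by (auto simp: zero_less_mult_iff)
      then show ?thesis by simp
    qed
  qed auto
  also have "\<dots> = ennreal (2 * y) * (ennreal (2 * (2 * y) powr (t - 1)) * lower_gamma t (1 / 2))"
    unfolding lower_gamma_def by (subst nn_integral_cmult) auto
  also have "\<dots> = ennreal (2 * (2 * y) powr t) * lower_gamma t (1 / 2)"
    using y by (simp add: mult.assoc[symmetric] powr_diff flip: ennreal_mult)
  finally show ?thesis .
qed

text \<open>Layer-cake: \<open>p\<^sup>r\<^sup>+\<^sup>1\<close> is the integral of \<open>(r + 1) u\<^sup>r\<close> over \<open>u \<le> p\<close>, and summing over the letters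
  turns the indicator of \<open>u \<le> p\<close> into the counting function.\<close>

lemma small_letters_sum_le:
  fixes p :: "nat pmf" and L :: "real \<Rightarrow> real"
  assumes supp: "set_pmf p \<subseteq> {1..}" and L: "antimono_on {0<..} L"
    and counting: "\<And>x. 0 < x \<Longrightarrow> x \<le> 1 \<Longrightarrow> real (card {k. k \<ge> 1 \<and> x \<le> pmf p k}) \<le> x powr (- \<alpha>) * L (1 / x)"
    and y: "0 < y" "y \<le> 1"
  shows "(\<integral>\<^sup>+k. ennreal (pmf p k ^ Suc r) * indicator {k. pmf p k < y} k \<partial>count_space UNIV)
    \<le> ennreal (real (Suc r) * L (1 / y)) * (\<integral>\<^sup>+u. ennreal (u powr (real r - \<alpha>)) * indicator {0<..<y} u \<partial>lborel)"
proof -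
  let ?h = "\<lambda>k u. ennreal (real (Suc r) * u ^ r) * indicator {0<..<y} u * indicator {u. u \<le> pmf p k} u"
  have "(\<integral>\<^sup>+k. ennreal (pmf p k ^ Suc r) * indicator {k. pmf p k < y} k \<partial>count_space UNIV)
      \<le> (\<integral>\<^sup>+k. (\<integral>\<^sup>+u. ?h k u \<partial>lborel) \<partial>count_space UNIV)"
  proof (intro nn_integral_mono)
    fix k
    show "ennreal (pmf p k ^ Suc r) * indicator {k. pmf p k < y} k \<le> (\<integral>\<^sup>+u. ?h k u \<partial>lborel)"
    proof (cases "pmf p k < y")
      case True
      have "(\<integral>\<^sup>+u. ennreal (real (Suc r) * u ^ r) * indicator {0..pmf p k} u \<partial>lborel) = pmf p k ^ Suc r - 0 ^ Suc r"
        using DERIV_pow[of "Suc r"]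
        by (intro nn_integral_FTC_Icc) (auto intro: has_field_derivative_at_within simp del: of_nat_Suc power_Suc)
      \<comment> \<open>The fundamental theorem of calculus was applied on a closed interval
        starting at 0, while \<open>?h\<close> lives on an open one; the point 0 is a null
        set.\<close>
      moreover have "(\<integral>\<^sup>+u. ennreal (real (Suc r) * u ^ r) * indicator {0..pmf p k} u \<partial>lborel) \<le> (\<integral>\<^sup>+u. ?h k u \<partial>lborel)"
        using True AE_lborel_singleton[of "0::real"]
        by (intro nn_integral_mono_AE) (auto simp: indicator_def elim!: eventually_mono)
      ultimately show ?thesis using True by simp
    qed simp
  qed
  also have "\<dots> = (\<Sum>k. (\<integral>\<^sup>+u. ?h k u \<partial>lborel))" by (rule nn_integral_count_space_nat)
  also have "\<dots> = (\<integral>\<^sup>+u. (\<Sum>k. ?h k u) \<partial>lborel)" by (rule nn_integral_suminf[symmetric]) simp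
  also have "\<dots> \<le> (\<integral>\<^sup>+u. ennreal (real (Suc r) * L (1 / y)) * (ennreal (u powr (real r - \<alpha>)) * indicator {0<..<y} u) \<partial>lborel)"
  proof (rule nn_integral_mono)
    fix u :: real
    show "(\<Sum>k. ?h k u) \<le> ennreal (real (Suc r) * L (1 / y)) * (ennreal (u powr (real r - \<alpha>)) * indicator {0<..<y} u)"
    proof (cases "0 < u \<and> u < y")
      case True
      then have u: "0 < u" "u < y" by auto
      have set: "{k. u \<le> pmf p k} = {k. k \<ge> 1 \<and> u \<le> pmf p k}"
        by (rule pmf_ge_eq[OF supp u(1)])
      have "(\<Sum>k. ?h k u) = (\<Sum>k. ennreal (real (Suc r) * u ^ r) * indicator {k. u \<le> pmf p k} k)"
        using u by (intro suminf_cong) (simp add: indicator_def)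
      also have "\<dots> = ennreal (real (Suc r) * u ^ r) * emeasure (count_space UNIV) {k. u \<le> pmf p k}"
        by (simp add: nn_integral_count_space_nat[symmetric] nn_integral_cmult)
      also have "\<dots> = ennreal (real (Suc r) * u ^ r * real (card {k. u \<le> pmf p k}))"
        using u by (simp add: finite_pmf_ge ennreal_mult flip: ennreal_of_nat_eq_real_of_nat)
      also have "\<dots> \<le> ennreal (real (Suc r) * u ^ r * (u powr (- \<alpha>) * L (1 / y)))"
      proof (intro ennreal_leI mult_left_mono)
        have "real (card {k. u \<le> pmf p k}) \<le> u powr (- \<alpha>) * L (1 / u)"
          using counting[of u] u y unfolding set by simp
        \<comment> \<open>Since \<open>1 / u\<close> exceeds \<open>1 / y\<close>, the
          non-increasing \<open>L\<close> can be frozen at \<open>1 / y\<close> and taken out of the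
          integral.\<close>
        also have "\<dots> \<le> u powr (- \<alpha>) * L (1 / y)"
          using u y by (intro mult_left_mono monotone_onD[OF L]) (auto simp: field_simps)
        finally show "real (card {k. u \<le> pmf p k}) \<le> u powr (- \<alpha>) * L (1 / y)" .
      qed (use u in auto)
      also have "real (Suc r) * u ^ r * (u powr (- \<alpha>) * L (1 / y)) = real (Suc r) * L (1 / y) * u powr (real r - \<alpha>)"
        using u by (simp add: powr_diff powr_minus powr_realpow field_simps)
      also have "ennreal \<dots> = ennreal (real (Suc r) * L (1 / y)) * (ennreal (u powr (real r - \<alpha>)) * indicator {0<..<y} u)"
        using u by (simp add: ennreal_mult'' indicator_def)
      finally show ?thesis .
    qed auto
  qed
  also have "\<dots> = ennreal (real (Suc r) * L (1 / y)) * (\<integral>\<^sup>+u. ennreal (u powr (real r - \<alpha>)) * indicator {0<..<y} u \<partial>lborel)"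
    by (rule nn_integral_cmult) simp
  finally show ?thesis .
qed

text \<open>The probability that exactly \<open>r\<close> of \<open>m\<close> independent letters
  from \<open>p\<close> agree with one further independent letter, computed by conditioning on the
  latter.\<close>

definition match_prob :: "nat pmf \<Rightarrow> nat \<Rightarrow> nat \<Rightarrow> real" where
  "match_prob p m r = measure_pmf.expectation p (\<lambda>k. pmf (binomial_pmf m (pmf p k)) r)"

text \<open>For the threshold \<open>1 / m\<close> the left-hand side collects the bound on the
  binomial coefficient, the layer-cake factor and the constant of \<open>lower_gamma_ge\<close>. The
  powers of \<open>m\<close> combine exactly; \<open>r + 1 \<le> 2 ^ r\<close> and
  \<open>2 powr t \<le> 2 ^ (r + 1)\<close>, with \<open>t\<close> the gamma parameter, produce
  \<open>4 ^ (r + 1)\<close>.\<close>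

lemma gamma_coefficient_le:
  fixes \<alpha> :: real and m r :: nat
  assumes \<alpha>: "0 \<le> \<alpha>" "\<alpha> \<le> 1" and m: "m > 0"
  shows "real (m ^ r) / fact r * (real (Suc r) * (2 * (2 * (1 / real m)) powr (1 + real r - \<alpha>)))
    \<le> 4 ^ (1 + r) / fact r * (1 + real r) powr (1 + real r - \<alpha>) * real m powr (- (1 - \<alpha>))"
proof -
  define t where "t = 1 + real r - \<alpha>"
  have t: "0 \<le> t" "t \<le> real (Suc r)" using \<alpha> by (auto simp: t_def)
  have "real (Suc r) \<le> real (2 ^ r)" by (intro of_nat_mono) (metis Suc_leI less_exp)
  moreover have "2 powr t \<le> 2 ^ Suc r" using t powr_mono[of t "real (Suc r)" 2] by (simp add: powr_realpow del: power_Suc of_nat_Suc)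
  ultimately have "real (Suc r) * (2 * 2 powr t) \<le> 2 ^ r * (2 * 2 ^ Suc r)" by (intro mult_mono) auto
  also have "\<dots> = 4 ^ Suc r * (1::real)" by (simp flip: power_mult_distrib)
  also have "\<dots> \<le> 4 ^ Suc r * (1 + real r) powr t" using t by (intro mult_left_mono ge_one_powr_ge_zero) auto
  finally have *: "real (Suc r) * (2 * 2 powr t) \<le> 4 ^ Suc r * (1 + real r) powr t" .
  have "real (m ^ r) * (2 * (1 / real m)) powr t = 2 powr t * real m powr (- (1 - \<alpha>))"
    using m by (simp add: t_def powr_divide powr_diff powr_add powr_minus powr_realpow field_simps)
  then have "real (m ^ r) / fact r * (real (Suc r) * (2 * (2 * (1 / real m)) powr t))
      = real (Suc r) * (2 * 2 powr t) * (real m powr (- (1 - \<alpha>)) / fact r)"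
    by (simp add: algebra_simps)
  also have "\<dots> \<le> 4 ^ Suc r * (1 + real r) powr t * (real m powr (- (1 - \<alpha>)) / fact r)"
    by (intro mult_right_mono *) auto
  finally show ?thesis by (simp add: t_def)
qed

text \<open>Letters are split at probability \<open>1 / m\<close>. The counting function bounds the
  number of frequent letters, each of which contributes at most \<open>c0 r / m\<close>. For a rare
  letter the binomial probability is at most \<open>m ^ r / fact r\<close> times the
  \<open>r\<close>-th power of its probability, and the layer-cake bound applies.\<close>

lemma match_prob_le:
  fixes p :: "nat pmf" and L :: "real \<Rightarrow> real"
  assumes supp: "set_pmf p \<subseteq> {1..}" and L: "antimono_on {0<..} L"
    and counting: "\<And>x. 0 < x \<Longrightarrow> x \<le> 1 \<Longrightarrow> real (card {k. k \<ge> 1 \<and> x \<le> pmf p k}) \<le> x powr (- \<alpha>) * L (1 / x)"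
    and \<alpha>: "0 \<le> \<alpha>" "\<alpha> \<le> 1" and m: "r < m" and L0: "0 \<le> L (real m)"
  shows "ennreal (match_prob p m r) \<le> (ennreal (c0 r) +
     ennreal (4 ^ (1 + r) / fact r * (1 + real r) powr (1 + real r - \<alpha>)) * lower_gamma (1 + real r - \<alpha>) (1 / 2)) *
     ennreal (real m powr (- (1 - \<alpha>)) * L (real m))"
proof -
  define g where "g k = pmf p k * pmf (binomial_pmf m (pmf p k)) r" for k
  let ?y = "1 / real m" and ?t = "1 + real r - \<alpha>"
  have y: "0 < ?y" "?y \<le> 1" using m by auto
  have g: "g k = pmf p k * (real (m choose r) * pmf p k ^ r * (1 - pmf p k) ^ (m - r))" for k
    by (simp add: g_def pmf_le_1)
  have "ennreal (match_prob p m r) = (\<integral>\<^sup>+k. ennreal (pmf (binomial_pmf m (pmf p k)) r) \<partial>p)"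
    unfolding match_prob_def
    by (intro nn_integral_eq_integral[symmetric] measure_pmf.integrable_const_bound[where B = 1]) (auto simp: pmf_le_1 simp del: pmf_binomial)
  also have "\<dots> = (\<integral>\<^sup>+k. ennreal (g k) \<partial>count_space UNIV)"
    by (simp add: nn_integral_measure_pmf g_def ennreal_mult del: pmf_binomial)
  also have "\<dots> \<le> (\<integral>\<^sup>+k. ennreal (c0 r / real m) * indicator {k. ?y \<le> pmf p k} k +
      ennreal (real (m ^ r) / fact r) * (ennreal (pmf p k ^ Suc r) * indicator {k. pmf p k < ?y} k) \<partial>count_space UNIV)"
  proof (rule nn_integral_mono)
    fix k
    show "ennreal (g k) \<le> ennreal (c0 r / real m) * indicator {k. ?y \<le> pmf p k} k +
      ennreal (real (m ^ r) / fact r) * (ennreal (pmf p k ^ Suc r) * indicator {k. pmf p k < ?y} k)"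
    proof (cases "?y \<le> pmf p k")
      case True
      then show ?thesis using mult_binomial_le[OF pmf_nonneg pmf_le_1 m, of p k] by (auto simp: g intro: ennreal_leI)
    next
      case False
      have "real ((m choose r) * fact r) \<le> real (m ^ r)" by (intro of_nat_mono binomial_fact_pow)
      then have "real (m choose r) \<le> real (m ^ r) / fact r" by (simp add: field_simps)
      moreover have "(1 - pmf p k) ^ (m - r) \<le> 1" by (intro power_le_one) (auto simp: pmf_le_1)
      ultimately have "real (m choose r) * (1 - pmf p k) ^ (m - r) * pmf p k ^ Suc r \<le> real (m ^ r) / fact r * 1 * pmf p k ^ Suc r"
        by (intro mult_mono) (auto simp: pmf_le_1)
      then show ?thesis using False by (simp add: g mult_ac ennreal_leI flip: ennreal_mult)
    qed
  qed
  also have "\<dots> = ennreal (c0 r / real m) * emeasure (count_space UNIV) {k. ?y \<le> pmf p k} +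
      ennreal (real (m ^ r) / fact r) * (\<integral>\<^sup>+k. ennreal (pmf p k ^ Suc r) * indicator {k. pmf p k < ?y} k \<partial>count_space UNIV)"
    by (simp add: nn_integral_add nn_integral_cmult)
  also have "\<dots> \<le> ennreal (c0 r) * ennreal (real m powr (- (1 - \<alpha>)) * L (real m)) +
      ennreal (4 ^ (1 + r) / fact r * (1 + real r) powr ?t) * lower_gamma ?t (1 / 2) * ennreal (real m powr (- (1 - \<alpha>)) * L (real m))"
  proof (intro add_mono)
    have set: "{k. ?y \<le> pmf p k} = {k. k \<ge> 1 \<and> ?y \<le> pmf p k}"
      by (rule pmf_ge_eq[OF supp y(1)])
    have c0: "0 \<le> c0 r" by (simp add: c0_def)
    have "ennreal (c0 r / real m) * emeasure (count_space UNIV) {k. ?y \<le> pmf p k} = ennreal (c0 r / real m * real (card {k. ?y \<le> pmf p k}))"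
      using y c0 by (simp only: ennreal_mult' divide_nonneg_nonneg of_nat_0_le_iff) (simp add: finite_pmf_ge ennreal_of_nat_eq_real_of_nat)
    also have "\<dots> \<le> ennreal (c0 r / real m * (?y powr (- \<alpha>) * L (real m)))"
      using counting[OF y] c0 unfolding set by (intro ennreal_leI mult_left_mono) auto
    also have "c0 r / real m * (?y powr (- \<alpha>) * L (real m)) = c0 r * (real m powr (- (1 - \<alpha>)) * L (real m))"
      using m by (simp add: powr_divide powr_diff powr_minus field_simps)
    finally show "ennreal (c0 r / real m) * emeasure (count_space UNIV) {k. ?y \<le> pmf p k}
        \<le> ennreal (c0 r) * ennreal (real m powr (- (1 - \<alpha>)) * L (real m))"
      using c0 L0 by (simp add: ennreal_mult)
    have rearrange1: "ennreal a * (ennreal (b * l) * (ennreal c * g)) = ennreal (a * (b * c) * l) * g"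
      if "0 \<le> a" "0 \<le> b" "0 \<le> l" "0 \<le> c" for a b c l :: real and g
      using that by (simp add: ennreal_mult) (simp add: mult_ac)
    have rearrange2: "ennreal (a * b * l) * g = ennreal a * g * ennreal (b * l)"
      if "0 \<le> a" "0 \<le> b" "0 \<le> l" for a b l :: real and g
      using that by (simp add: ennreal_mult) (simp add: mult_ac)
    have "(\<integral>\<^sup>+k. ennreal (pmf p k ^ Suc r) * indicator {k. pmf p k < ?y} k \<partial>count_space UNIV)
        \<le> ennreal (real (Suc r) * L (real m)) * (ennreal (2 * (2 * ?y) powr ?t) * lower_gamma ?t (1 / 2))"
      using small_letters_sum_le[OF supp L counting y, of r]
        mult_left_mono[OF lower_gamma_ge[OF y(1), of ?t], of "ennreal (real (Suc r) * L (real m))"]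
      by (simp add: add.commute)
    then have "ennreal (real (m ^ r) / fact r) * (\<integral>\<^sup>+k. ennreal (pmf p k ^ Suc r) * indicator {k. pmf p k < ?y} k \<partial>count_space UNIV)
        \<le> ennreal (real (m ^ r) / fact r) * (ennreal (real (Suc r) * L (real m)) * (ennreal (2 * (2 * ?y) powr ?t) * lower_gamma ?t (1 / 2)))"
      by (intro mult_left_mono) auto
    also have "\<dots> = ennreal (real (m ^ r) / fact r * (real (Suc r) * (2 * (2 * ?y) powr ?t)) * L (real m)) * lower_gamma ?t (1 / 2)"
      using L0 by (intro rearrange1) auto
    also have "\<dots> \<le> ennreal (4 ^ (1 + r) / fact r * (1 + real r) powr ?t * real m powr (- (1 - \<alpha>)) * L (real m)) * lower_gamma ?t (1 / 2)"
      using L0 m by (intro mult_right_mono ennreal_leI gamma_coefficient_le \<alpha>) auto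
    also have "\<dots> = ennreal (4 ^ (1 + r) / fact r * (1 + real r) powr ?t) * lower_gamma ?t (1 / 2) * ennreal (real m powr (- (1 - \<alpha>)) * L (real m))"
      using L0 by (intro rearrange2) auto
    finally show "ennreal (real (m ^ r) / fact r) * (\<integral>\<^sup>+k. ennreal (pmf p k ^ Suc r) * indicator {k. pmf p k < ?y} k \<partial>count_space UNIV) \<le> \<dots>" .
  qed
  finally show ?thesis by (simp add: distrib_right)
qed

lemma match_prob_eq_0: "m < r \<Longrightarrow> match_prob p m r = 0"
  by (simp add: match_prob_def pmf_le_1)

text \<open>For \<open>m = r\<close> the binomial probability is the \<open>r\<close>-th power of
  the letter probability. Letters of probability below \<open>1 / r\<close> give the term
  \<open>real r powr (- real r)\<close>. The other letters have total mass at most \<open>s\<close>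
  times their number, which the counting function bounds.\<close>

lemma match_prob_diag_le:
  fixes p :: "nat pmf" and L :: "real \<Rightarrow> real"
  assumes supp: "set_pmf p \<subseteq> {1..}"
    and counting: "\<And>x. 0 < x \<Longrightarrow> x \<le> 1 \<Longrightarrow> real (card {k. k \<ge> 1 \<and> x \<le> pmf p k}) \<le> x powr (- \<alpha>) * L (1 / x)"
    and s: "\<And>k. k \<ge> 1 \<Longrightarrow> pmf p k \<le> s" and r: "r \<ge> 1"
  shows "match_prob p r r \<le> min 1 (s ^ (r + 1) * real r powr \<alpha> * L (real r) + real r powr (- real r))"
proof -
  define A where "A = {k. k \<ge> 1 \<and> 1 / real r \<le> pmf p k}"
  have fin: "finite A" unfolding A_def by (rule finite_subset[OF _ finite_pmf_ge[of "1 / real r" p]]) (use r in auto)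
  have s0: "0 \<le> s" using s[of 1] pmf_nonneg[of p 1] by linarith
  have eq: "match_prob p r r = measure_pmf.expectation p (\<lambda>k. pmf p k ^ r)"
    by (simp add: match_prob_def pmf_le_1)
  have int: "integrable p (\<lambda>k. pmf p k ^ r)"
    by (intro measure_pmf.integrable_const_bound[where B = 1]) (auto simp: pmf_le_1 power_le_one)
  have "match_prob p r r \<le> measure_pmf.expectation p (\<lambda>_. 1)"
    unfolding eq by (intro integral_mono int) (auto simp: pmf_le_1 power_le_one)
  then have 1: "match_prob p r r \<le> 1" by simp
  have intA: "integrable p (\<lambda>k. s ^ r * indicator A k)"
    by (intro measure_pmf.integrable_const_bound[where B = "s ^ r"]) (auto simp: s0 split: split_indicator)
  have "match_prob p r r \<le> measure_pmf.expectation p (\<lambda>k. s ^ r * indicator A k + real r powr (- real r))"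
    unfolding eq
  proof (intro integral_mono_AE int)
    show "AE k in p. pmf p k ^ r \<le> s ^ r * indicator A k + real r powr (- real r)"
    proof (subst AE_measure_pmf_iff, intro ballI)
      fix k assume "k \<in> set_pmf p"
      then have k: "k \<ge> 1" using supp by auto
      show "pmf p k ^ r \<le> s ^ r * indicator A k + real r powr (- real r)"
      proof (cases "k \<in> A")
        case True
        then show ?thesis using power_mono[OF s[OF k] pmf_nonneg, of r] by (simp add: add_increasing2)
      next
        case False
        then have "pmf p k ^ r \<le> (1 / real r) ^ r" using k by (intro power_mono) (auto simp: A_def)
        then show ?thesis using False r by (simp add: powr_minus powr_realpow power_divide inverse_eq_divide)
      qed
    qed
  qed (intro Bochner_Integration.integrable_add intA, simp)
  also have "\<dots> = s ^ r * measure_pmf.prob p A + real r powr (- real r)"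
    by (subst Bochner_Integration.integral_add) (rule intA, simp_all)
  also have "measure_pmf.prob p A \<le> real (card A) * s"
    unfolding measure_measure_pmf_finite[OF fin] by (rule sum_bounded_above) (auto simp: A_def s)
  also have "real (card A) \<le> real r powr \<alpha> * L (real r)"
    using counting[of "1 / real r"] r by (simp add: A_def powr_divide powr_minus)
  finally have "match_prob p r r \<le> s ^ r * (real r powr \<alpha> * L (real r) * s) + real r powr (- real r)"
    using s0 by (simp add: mult_left_mono mult_right_mono)
  then show ?thesis using 1 by (simp add: mult_ac)
qed

section \<open>Reduction to the underlying chain\<close>

definition attach_letters :: "('a \<Rightarrow> 'b pmf) \<Rightarrow> 'a pmf \<Rightarrow> ('a \<times> 'b) pmf" where
  "attach_letters P p = bind_pmf p (\<lambda>a. map_pmf (Pair a) (P a))"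

lemma pmf_attach_letters:
  fixes p :: "'a::finite pmf"
  shows "pmf (attach_letters P p) (a, k) = pmf p a * pmf (P a) k"
proof -
  have "pmf (map_pmf (Pair b) (P b)) (a, k) = of_bool (b = a) * pmf (P a) k" for b
    by (cases "b = a") (auto simp: pmf_map_inj' inj_on_def intro: pmf_map_outside)
  then show ?thesis
    by (simp add: attach_letters_def pmf_bind_finite of_bool_def mult_delta_left mult_delta_right)
qed

primrec letters_pmf :: "('a \<Rightarrow> 'b pmf) \<Rightarrow> 'a list \<Rightarrow> ('a \<times> 'b) list pmf" where
  "letters_pmf P [] = return_pmf []"
| "letters_pmf P (x # xs) = bind_pmf (P x) (\<lambda>k. map_pmf ((#) (x, k)) (letters_pmf P xs))"

lemma letters_pmf_hd:
  "zs \<in> set_pmf (letters_pmf P xs) \<Longrightarrow> xs \<noteq> [] \<Longrightarrow> fst (hd zs) = hd xs"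
  by (cases xs) auto

text \<open>The next regime depends on the current pair only through its regime, so the two kinds of
  draws commute and all letters can be drawn after the whole regime trajectory.\<close>

lemma path_attach_letters:
  "path_pmf (attach_letters P \<eta>) (\<lambda>z. attach_letters P (Q (fst z))) n = bind_pmf (path_pmf \<eta> Q n) (letters_pmf P)"
proof (induction n)
  case 0
  show ?case by (simp add: attach_letters_def map_bind_pmf bind_map_pmf pmf.map_comp comp_def)
    (simp add: map_pmf_def)
next
  case (Suc n)
  have "bind_pmf (letters_pmf P xs) (\<lambda>zs. map_pmf (\<lambda>z. z # zs) (attach_letters P (Q (fst (hd zs)))))
      = bind_pmf (Q (hd xs)) (\<lambda>x. letters_pmf P (x # xs))" if xs: "xs \<in> set_pmf (path_pmf \<eta> Q n)" for xs
  proof -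
    have "bind_pmf (letters_pmf P xs) (\<lambda>zs. map_pmf (\<lambda>z. z # zs) (attach_letters P (Q (fst (hd zs)))))
      = bind_pmf (letters_pmf P xs) (\<lambda>zs. map_pmf (\<lambda>z. z # zs) (attach_letters P (Q (hd xs))))"
      using length_path_pmf[OF xs] by (intro bind_pmf_cong refl) (subst letters_pmf_hd, auto)
    also have "\<dots> = bind_pmf (letters_pmf P xs) (\<lambda>zs. bind_pmf (Q (hd xs)) (\<lambda>x. bind_pmf (P x) (\<lambda>k. return_pmf ((x, k) # zs))))"
      by (simp add: attach_letters_def map_pmf_def bind_assoc_pmf bind_return_pmf)
    also have "\<dots> = bind_pmf (Q (hd xs)) (\<lambda>x. bind_pmf (P x) (\<lambda>k. bind_pmf (letters_pmf P xs) (\<lambda>zs. return_pmf ((x, k) # zs))))"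
      by (subst bind_commute_pmf, subst bind_commute_pmf) (rule refl)
    also have "\<dots> = bind_pmf (Q (hd xs)) (\<lambda>x. letters_pmf P (x # xs))"
      by (simp add: map_pmf_def)
    finally show ?thesis .
  qed
  then show ?case
    unfolding path_pmf.simps Suc bind_assoc_pmf bind_map_pmf by (intro bind_pmf_cong refl)
qed

lemma map_pmf_eq_bernoulli: "map_pmf (\<lambda>j. j = k) p = bernoulli_pmf (pmf p k)"
proof (rule pmf_eqI)
  fix b
  have "(\<lambda>j. j = k) -` {b} = (if b then {k} else UNIV - {k})" by auto
  then show "pmf (map_pmf (\<lambda>j. j = k) p) b = pmf (bernoulli_pmf (pmf p k)) b"
    using measure_pmf.prob_compl[of "{k}" p] by (auto simp: pmf_map pmf_le_1 measure_pmf_single)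
qed

text \<open>Only positions in regime \<open>a\<close> can produce the pair \<open>(a, k)\<close>,
  and each of them does so independently with the probability of \<open>k\<close> under
  \<open>P a\<close>.\<close>

lemma count_letters_pmf:
  "map_pmf (\<lambda>zs. count_list zs (a, k)) (letters_pmf P xs) = binomial_pmf (count_list xs a) (pmf (P a) k)"
proof (induction xs)
  case Nil
  show ?case by (simp add: binomial_pmf_0 pmf_le_1)
next
  case (Cons x xs)
  show ?case
  proof (cases "x = a")
    case True
    have "map_pmf (\<lambda>zs. count_list zs (a, k)) (letters_pmf P (x # xs))
      = bind_pmf (P a) (\<lambda>j. map_pmf (\<lambda>i. (if j = k then 1 else 0) + i) (map_pmf (\<lambda>zs. count_list zs (a, k)) (letters_pmf P xs)))"
      unfolding letters_pmf.simps map_bind_pmf pmf.map_comp True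
      by (intro bind_pmf_cong refl pmf.map_cong) auto
    also have "\<dots> = bind_pmf (map_pmf (\<lambda>j. j = k) (P a)) (\<lambda>b. bind_pmf (binomial_pmf (count_list xs a) (pmf (P a) k)) (\<lambda>i. return_pmf ((if b then 1 else 0) + i)))"
      unfolding Cons bind_map_pmf by (simp add: map_pmf_def)
    also have "\<dots> = binomial_pmf (Suc (count_list xs a)) (pmf (P a) k)"
      unfolding map_pmf_eq_bernoulli by (subst binomial_pmf_Suc) (auto simp: pmf_le_1)
    finally show ?thesis using True by simp
  next
    case False
    have "map_pmf (\<lambda>zs. count_list zs (a, k)) (letters_pmf P (x # xs))
      = bind_pmf (P x) (\<lambda>j. map_pmf (\<lambda>zs. count_list zs (a, k)) (letters_pmf P xs))"
      unfolding letters_pmf.simps map_bind_pmf pmf.map_comp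
      using False by (intro bind_pmf_cong refl pmf.map_cong) auto
    then show ?thesis using False Cons by simp
  qed
qed

lemma pmf_matches_letters_pmf:
  "pmf (map_pmf (\<lambda>zs. count_list (tl zs) (hd zs)) (letters_pmf P (x # xs))) r = match_prob (P x) (count_list xs x) r"
  unfolding match_prob_def letters_pmf.simps map_bind_pmf pmf.map_comp comp_def list.sel count_letters_pmf
  by (rule pmf_bind)

section \<open>Law of the history of an abstract Markov chain\<close>

lemma pmf_path_Cons: "pmf (path_pmf \<eta> K (Suc n)) (x # xs) = pmf (path_pmf \<eta> K n) xs * pmf (K (hd xs)) x"
proof -
  have "pmf (map_pmf (\<lambda>x. x # ys) (K (hd ys))) (x # xs) = indicator {xs} ys * pmf (K (hd xs)) x" for ys
    by (cases "ys = xs") (auto simp: pmf_map_inj'[of "\<lambda>x. x # xs"] inj_on_def intro: pmf_map_outside)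
  then show ?thesis by (simp add: pmf_bind measure_pmf_single)
qed

lemma set_path_pmf:
  assumes "set_pmf \<eta> \<subseteq> S" "\<And>z. z \<in> S \<Longrightarrow> set_pmf (K z) \<subseteq> S" "zs \<in> set_pmf (path_pmf \<eta> K n)"
  shows "set zs \<subseteq> S"
  using assms(3)
proof (induction n arbitrary: zs)
  case 0
  then show ?case using assms(1) by auto
next
  case (Suc n)
  then obtain x xs where xs: "zs = x # xs" "xs \<in> set_pmf (path_pmf \<eta> K n)" "x \<in> set_pmf (K (hd xs))" by auto
  from length_path_pmf[OF xs(2)] have "hd xs \<in> set xs" by (cases xs) auto
  then show ?case using xs Suc.IH[OF xs(2)] assms(2)[of "hd xs"] by auto
qed

text \<open>Times \<open>n + 1\<close> down to \<open>1\<close>, in the order used by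
  \<open>path_pmf\<close>.\<close>

abbreviation history :: "(nat \<Rightarrow> 'w \<Rightarrow> 's) \<Rightarrow> nat \<Rightarrow> 'w \<Rightarrow> 's list" where
  "history Z n w \<equiv> map (\<lambda>i. Z i w) (rev [1..<Suc (Suc n)])"

text \<open>Chain rule for conditional probabilities. The Markov property is available only after
  histories of positive probability; after a null history both sides vanish.\<close>

lemma markov_chain_path_prob:
  assumes mc: "markov_chain M S Z (pmf \<eta>) (\<lambda>z. pmf (K z))" and z: "\<And>i. i \<in> {1..Suc n} \<Longrightarrow> z i \<in> S"
  shows "\<P>(w in M. \<forall>i\<in>{1..Suc n}. Z i w = z i) = pmf (path_pmf \<eta> K n) (map z (rev [1..<Suc (Suc n)]))"
  using z
proof (induction n)
  case 0
  have "pmf (map_pmf (\<lambda>x. [x]) \<eta>) [z 1] = pmf \<eta> (z 1)"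
    by (subst pmf_map_inj'[of "\<lambda>x. [x]"]) (auto simp: inj_on_def)
  then show ?case using 0 mc by (auto simp: markov_chain_def)
next
  case (Suc n)
  interpret prob_space M using mc by (simp add: markov_chain_def)
  let ?E = "\<lambda>n. {w \<in> space M. \<forall>i\<in>{1..Suc n}. Z i w = z i}"
  have sets: "?E j \<in> sets M" if "j \<le> Suc n" for j
  proof -
    have "{w \<in> space M. Z i w = z i} \<in> sets M" if "i \<in> {1..Suc j}" for i
    proof -
      have "Z i \<in> M \<rightarrow>\<^sub>M count_space S" "z i \<in> S" using mc that \<open>j \<le> Suc n\<close> Suc.prems[of i] by (auto simp: markov_chain_def)
      from measurable_sets[OF this(1), of "{z i}"] this(2) show ?thesis by (simp add: vimage_def Int_def conj_commute)
    qed
    then show ?thesis by (intro sets.sets_Collect_finite_All) auto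
  qed
  have sub: "?E (Suc n) \<subseteq> ?E n" by auto
  have IH: "prob (?E n) = pmf (path_pmf \<eta> K n) (map z (rev [1..<Suc (Suc n)]))" using Suc by auto
  have p: "pmf (path_pmf \<eta> K (Suc n)) (map z (rev [1..<Suc (Suc (Suc n))])) = prob (?E n) * pmf (K (z (Suc n))) (z (Suc (Suc n)))"
    using pmf_path_Cons[of \<eta> K n "z (Suc (Suc n))" "map z (rev [1..<Suc (Suc n)])"] unfolding IH by simp
  show ?case
  proof (cases "prob (?E n) > 0")
    case True
    have "\<P>(w in M. Z (Suc (Suc n)) w = z (Suc (Suc n)) \<bar> \<forall>i\<in>{1..Suc n}. Z i w = z i) = pmf (K (z (Suc n))) (z (Suc (Suc n)))"
      using mc True Suc.prems unfolding markov_chain_def by (elim conjE allE[of _ "Suc n"] allE[of _ z]) auto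
    moreover have "{w \<in> space M. Z (Suc (Suc n)) w = z (Suc (Suc n)) \<and> (\<forall>i\<in>{1..Suc n}. Z i w = z i)} = ?E (Suc n)"
      by (auto simp: atLeastAtMostSuc_conv)
    ultimately show ?thesis using True unfolding p cond_prob_def by (simp add: field_simps)
  next
    case False
    then have "prob (?E n) = 0" by (simp add: not_less measure_le_0_iff)
    moreover have "prob (?E (Suc n)) \<le> prob (?E n)" by (intro finite_measure_mono sub sets) auto
    ultimately show ?thesis unfolding p by (simp add: measure_le_0_iff)
  qed
qed

text \<open>Lists over a countable type are countable, so single trajectories determine
  measurability and law. Lists that leave \<open>S\<close> or have the wrong length get probability
  0 on both sides.\<close>

lemma distr_history:
  fixes Z :: "nat \<Rightarrow> 'w \<Rightarrow> 's::countable"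
  assumes mc: "markov_chain M S Z (pmf \<eta>) (\<lambda>z. pmf (K z))"
    and S: "set_pmf \<eta> \<subseteq> S" "\<And>z. z \<in> S \<Longrightarrow> set_pmf (K z) \<subseteq> S"
  shows "history Z n \<in> M \<rightarrow>\<^sub>M count_space UNIV" "distr M (count_space UNIV) (history Z n) = path_pmf \<eta> K n"
proof -
  interpret prob_space M using mc by (simp add: markov_chain_def)
  have Z: "Z i \<in> M \<rightarrow>\<^sub>M count_space S" if "i \<ge> 1" for i using mc that by (simp add: markov_chain_def)
  have "{w \<in> space M. history Z n w = zs} \<in> sets M" for zs
  proof (cases "\<exists>z. zs = map z (rev [1..<Suc (Suc n)])")
    case True
    then obtain z where z: "zs = map z (rev [1..<Suc (Suc n)])" by blast
    have "{w \<in> space M. Z i w = z i} \<in> sets M" if "i \<in> {1..<Suc (Suc n)}" for i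
    proof -
      have "{w \<in> space M. Z i w = z i} = Z i -` ({z i} \<inter> S) \<inter> space M"
        using measurable_space[OF Z[of i]] that by auto
      then show ?thesis using measurable_sets[OF Z[of i], of "{z i} \<inter> S"] that by simp
    qed
    then have "{w \<in> space M. \<forall>i\<in>{1..<Suc (Suc n)}. Z i w = z i} \<in> sets M" by (intro sets.sets_Collect_finite_All) auto
    then show ?thesis unfolding z map_eq_conv by (simp del: upt_Suc)
  next
    case False
    then have "{w \<in> space M. history Z n w = zs} = {}" by auto
    then show ?thesis by (simp only: sets.empty_sets)
  qed
  then show meas: "history Z n \<in> M \<rightarrow>\<^sub>M count_space UNIV"
    by (subst measurable_count_space_eq_countable) (auto simp: vimage_def Int_def conj_commute simp del: upt_Suc)
  show "distr M (count_space UNIV) (history Z n) = path_pmf \<eta> K n"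
  proof (rule measure_eqI_countable)
    fix zs :: "'s list"
    have d: "emeasure (distr M (count_space UNIV) (history Z n)) {zs} = ennreal (\<P>(w in M. history Z n w = zs))"
      by (subst emeasure_distr[OF meas]) (auto simp: emeasure_eq_measure vimage_def Int_def conj_commute simp del: upt_Suc)
    have "\<P>(w in M. history Z n w = zs) = pmf (path_pmf \<eta> K n) zs"
    proof (cases "length zs = Suc n \<and> set zs \<subseteq> S")
      case True
      \<comment> \<open>The list starts with the latest state, so time \<open>i\<close> sits at
        index \<open>n + 1 - i\<close>.\<close>
      define z where "z i = zs ! (Suc n - i)" for i
      have zs: "zs = map z (rev [1..<Suc (Suc n)])"
        using True by (intro nth_equalityI) (auto simp: z_def rev_nth simp del: upt_Suc)
      have "z i \<in> S" if "i \<in> {1..Suc n}" for i using that True by (auto simp: z_def intro!: subsetD[OF _ nth_mem])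
      from markov_chain_path_prob[OF mc this] show ?thesis
        unfolding zs map_eq_conv by (simp add: atLeastLessThanSuc_atLeastAtMost del: upt_Suc)
    next
      case False
      have "{w \<in> space M. history Z n w = zs} = {}"
        using False measurable_space[OF Z] by (auto simp del: upt_Suc)
      moreover have "zs \<notin> set_pmf (path_pmf \<eta> K n)"
        using False set_path_pmf[of \<eta> S K zs n, OF S] length_path_pmf[of zs \<eta> K n] by blast
      ultimately show ?thesis by (simp only: set_pmf_iff not_not measure_empty)
    qed
    then show "emeasure (distr M (count_space UNIV) (history Z n)) {zs} = emeasure (path_pmf \<eta> K n) {zs}"
      unfolding d by (simp add: emeasure_pmf_single)
  qed auto
qed

lemma count_list_history: "count_list (map (\<lambda>i. Z i w) (rev [1..<Suc n])) x = (\<Sum>i=1..n. of_bool (Z i w = x))"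
  by (induction n) auto

text \<open>The abstract probability space disappears here: given the regimes, only the number of
  earlier visits to the last regime and the letter law of that regime matter.\<close>

lemma prob_num_matches:
  fixes Q :: "'a::finite \<Rightarrow> 'a pmf"
  assumes Z: "regime_switching M Z P Q \<eta>" and letters: "\<And>a. set_pmf (P a) \<subseteq> {1..}"
  shows "\<P>(w in M. num_matches Z n w = r)
    = measure_pmf.expectation (path_pmf \<eta> Q n) (\<lambda>xs. match_prob (P (hd xs)) (count_list (tl xs) (hd xs)) r)"
proof -
  let ?S = "UNIV \<times> {1..} :: ('a \<times> nat) set" and ?f = "\<lambda>zs. count_list (tl zs) (hd zs)"
  let ?\<eta> = "attach_letters P \<eta>" and ?K = "\<lambda>z. attach_letters P (Q (fst z))"
  have mc: "markov_chain M ?S Z (pmf ?\<eta>) (\<lambda>z. pmf (?K z))"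
  proof -
    have 1: "(\<lambda>(a, k). pmf \<eta> a * pmf (P a) k) = pmf ?\<eta>" by (auto simp: fun_eq_iff pmf_attach_letters)
    have 2: "(\<lambda>(a', k') (a, k). pmf (Q a') a * pmf (P a) k) = (\<lambda>z. pmf (?K z))"
      by (auto simp: fun_eq_iff pmf_attach_letters)
    show ?thesis using Z unfolding regime_switching_def 1 2 .
  qed
  have S: "set_pmf (attach_letters P p) \<subseteq> ?S" for p using letters by (auto simp: attach_letters_def)
  have nm: "num_matches Z n w = ?f (history Z n w)" for w
  proof -
    have "history Z n w = Z (Suc n) w # map (\<lambda>i. Z i w) (rev [1..<Suc n])" by (subst upt_Suc) simp
    then show ?thesis by (simp only: num_matches_def list.sel count_list_history)
  qed
  have "\<P>(w in M. num_matches Z n w = r) = measure (distr M (count_space UNIV) (history Z n)) {zs. ?f zs = r}"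
    by (subst measure_distr[OF distr_history(1)[OF mc S S]]) (auto simp: nm vimage_def Int_def conj_commute simp del: upt_Suc)
  also have "\<dots> = pmf (map_pmf ?f (path_pmf ?\<eta> ?K n)) r"
    unfolding distr_history(2)[OF mc S S] by (simp add: pmf_map vimage_def)
  also have "\<dots> = measure_pmf.expectation (path_pmf \<eta> Q n) (\<lambda>xs. pmf (map_pmf ?f (letters_pmf P xs)) r)"
    unfolding path_attach_letters map_bind_pmf pmf_bind ..
  also have "\<dots> = measure_pmf.expectation (path_pmf \<eta> Q n) (\<lambda>xs. match_prob (P (hd xs)) (count_list (tl xs) (hd xs)) r)"
  proof (rule integral_cong_AE)
    have "pmf (map_pmf ?f (letters_pmf P xs)) r = match_prob (P (hd xs)) (count_list (tl xs) (hd xs)) r"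
      if "xs \<in> set_pmf (path_pmf \<eta> Q n)" for xs
      using length_path_pmf[OF that] pmf_matches_letters_pmf[of P "hd xs" "tl xs" r] by (cases xs) auto
    then show "AE xs in path_pmf \<eta> Q n. pmf (map_pmf ?f (letters_pmf P xs)) r = match_prob (P (hd xs)) (count_list (tl xs) (hd xs)) r"
      by (subst AE_measure_pmf_iff) blast
  qed auto
  finally show ?thesis .
qed

section \<open>The match probability bound\<close>

text \<open>The base \<open>u\<close> of the square in the stated exponent may be slightly negative. With \<open>s = \<lambda> / t\<^sub>0\<close> and
  \<open>y = s D\<close>, where \<open>D\<close> is the deviation, one has \<open>n u = y - 1 - s\<close>; the hypothesis gives \<open>y > 1 \<ge> s\<close>, so
  \<open>|n u| \<le> y\<close> whatever the sign.\<close>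

lemma tail_exponent:
  fixes lam v w x t :: real
  assumes lam: "0 < lam" "lam \<le> 1" and t: "1 \<le> t" and w: "0 \<le> w" "w \<le> 1" and n: "n \<ge> 1"
    and h: "real n > (2 * t + x * lam + lam * (1 - w)) / (lam * v)" and v: "0 < v"
  shows "0 < real n * v - x - t / lam"
    and "- 2 * (real n * v - x - t / lam)\<^sup>2 / (real n * (t / lam)\<^sup>2)
      \<le> - (real n / 2 * (lam * v / t - (2 + (x + 1) * lam / t) / real n)\<^sup>2)"
proof -
  define s where "s = lam / t"
  define y where "y = s * (real n * v - x) - 1"
  have s: "0 < s" "s \<le> 1" using lam t by (auto simp: s_def)
  have "2 * t + x * lam + lam * (1 - w) < real n * (lam * v)"
    using h lam v by (simp add: pos_divide_less_eq)
  then have st: "(2 * t + x * lam + lam * (1 - w)) / t < real n * (lam * v) / t" using t by (intro divide_strict_right_mono) auto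
  have "2 + x * s + s * (1 - w) < real n * (s * v)"
  proof -
    have "(2 * t + x * lam + lam * (1 - w)) / t = 2 + x * s + s * (1 - w)" using t by (simp add: s_def field_simps)
    moreover have "real n * (lam * v) / t = real n * (s * v)" by (simp add: s_def)
    ultimately show ?thesis using st by simp
  qed
  then have y: "1 + s * (1 - w) < y" by (simp add: y_def algebra_simps)
  have sw: "0 \<le> s * (1 - w)" "s * w \<le> 1" using s w mult_mono[of s 1 w 1] by auto
  have D: "real n * v - x - t / lam = y / s" using lam t by (simp add: y_def s_def field_simps)
  show "0 < real n * v - x - t / lam" unfolding D using y sw s by (intro divide_pos_pos) linarith+
  have u: "lam * v / t - (2 + (x + 1) * lam / t) / real n = (y - 1 - s) / real n"
    using n by (simp add: y_def s_def divide_simps) (simp add: algebra_simps)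
  have "\<bar>y - 1 - s\<bar> \<le> \<bar>y\<bar>" using y s sw(1) by linarith
  then have "(y - 1 - s)\<^sup>2 \<le> y\<^sup>2" by (simp add: abs_le_square_iff)
  \<comment> \<open>In terms of \<open>y\<close> the Chernoff exponent is
    \<open>4 * y\<^sup>2 / (2 * n)\<close>, whence the factor 4.\<close>
  then have "(y - 1 - s)\<^sup>2 \<le> 4 * y\<^sup>2" using zero_le_power2[of y] by linarith
  then have "(y - 1 - s)\<^sup>2 / (2 * real n) \<le> 4 * y\<^sup>2 / (2 * real n)" by (intro divide_right_mono) auto
  moreover have "- 2 * (y / s)\<^sup>2 / (real n * (t / lam)\<^sup>2) = - (4 * y\<^sup>2 / (2 * real n))"
  proof -
    have "t / lam = 1 / s" by (simp add: s_def)
    then show ?thesis using s n by (simp add: power_divide)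
  qed
  moreover have "real n / 2 * ((y - 1 - s) / real n)\<^sup>2 = (y - 1 - s)\<^sup>2 / (2 * real n)"
    using n by (simp add: power2_eq_square)
  ultimately show "- 2 * (real n * v - x - t / lam)\<^sup>2 / (real n * (t / lam)\<^sup>2)
      \<le> - (real n / 2 * (lam * v / t - (2 + (x + 1) * lam / t) / real n)\<^sup>2)"
    unfolding D u by linarith
qed

theorem corollary4p1:
  fixes M :: "'w measure"
    and Z :: "nat \<Rightarrow> 'w \<Rightarrow> 'a::finite \<times> nat"
    and P :: "'a \<Rightarrow> nat pmf"
    and Q :: "'a \<Rightarrow> 'a pmf"
    and \<pi> \<eta> :: "'a pmf"
    and t0 r n :: nat
    and \<alpha> \<epsilon> :: real
    and L :: "real \<Rightarrow> real"
  assumes letters: "\<And>a. set_pmf (P a) \<subseteq> {1..}"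
    and Z: "regime_switching M Z P Q \<eta>"
    and irreducible: "irreducible_kernel (trans_mat Q)"
    and aperiodic: "aperiodic_kernel (trans_mat Q)"
    and stationary: "stationary Q \<pi>"
    and t0: "t0 \<ge> 1" "\<And>a b. kernel_power (trans_mat Q) t0 a b > 0"
    and \<alpha>: "0 \<le> \<alpha>" "\<alpha> \<le> 1"
    and L: "antimono_on {0<..} L" "slowly_varying L"
    and counting: "\<And>a x. 0 < x \<Longrightarrow> x \<le> 1 \<Longrightarrow> counting_fun P a x \<le> x powr (- \<alpha>) * L (1 / x)"
    and \<epsilon>: "0 < \<epsilon>" "\<epsilon> < pi_min \<pi>"
    and n: "real n >
      max ((2 * real t0 + real r * mixing_const Q \<pi> t0 + mixing_const Q \<pi> t0 * (1 - pi_min \<pi>))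
             / (mixing_const Q \<pi> t0 * pi_min \<pi>))
          ((2 * real t0 + mixing_const Q \<pi> t0 * (1 - pi_min \<pi>))
             / (mixing_const Q \<pi> t0 * (pi_min \<pi> - \<epsilon>)))"
  shows "ereal \<P>(w in M. num_matches Z n w = r) \<le> H_bound P Q \<pi> \<eta> t0 \<alpha> L r n \<epsilon>"
proof -
  define lam where "lam = mixing_const Q \<pi> t0"
  define C where "C = init_const \<eta> \<pi>"
  define G where "G = lower_gamma (1 + real r - \<alpha>) (1 / 2)"
  define q where "q = 4 ^ (1 + r) / fact r * (1 + real r) powr (1 + real r - \<alpha>)"
  define e2 where "e2 = exp (- (real n / 2 * (lam * pi_min \<pi> / real t0 - (2 + (real r + 1) * lam / real t0) / real n)\<^sup>2))"
  define e3 where "e3 = exp (- (real n / 2 * (lam * (pi_min \<pi> - \<epsilon>) / real t0 - (2 + lam / real t0) / real n)\<^sup>2))"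
  \<comment> \<open>The decay rate of the bound: the first summand of \<open>H_bound\<close> takes
    it at \<open>n * \<epsilon>\<close>, and \<open>c3\<close> at \<open>r + 1\<close>.\<close>
  define h where "h x = x powr (- (1 - \<alpha>)) * L x" for x
  have H: "H_bound P Q \<pi> \<eta> t0 \<alpha> L r n \<epsilon> = c1 \<alpha> r * ereal (h (real n * \<epsilon>))
      + ereal (c2 P L \<alpha> r * C * e2) + c1 \<alpha> r * ereal (h (real r + 1)) * ereal (C * e3)"
    by (simp add: H_bound_def Let_def c3_def lam_def C_def e2_def e3_def h_def)
  have counting': "real (card {k. k \<ge> 1 \<and> x \<le> pmf (P a) k}) \<le> x powr (- \<alpha>) * L (1 / x)"
    if "0 < x" "x \<le> 1" for a x
    using counting[OF that, of a] by (simp add: counting_fun_def)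

  \<comment> \<open>Some letter has positive probability, so the counting function is at least 1 at
    all small arguments. The counting bound then forces \<open>L\<close> to be positive at large
    arguments, and monotonicity extends this to all positive ones.\<close>
  have Lpos: "0 < L x" if "0 < x" for x
  proof -
    obtain k where k: "k \<in> set_pmf (P undefined)" using set_pmf_not_empty by fast
    define y where "y = min (min 1 (1 / x)) (pmf (P undefined) k)"
    have y: "0 < y" "y \<le> 1" "y \<le> 1 / x" "y \<le> pmf (P undefined) k"
      using k that by (auto simp: y_def pmf_positive)
    have "k \<in> {k. k \<ge> 1 \<and> y \<le> pmf (P undefined) k}" using letters[of undefined] k y by auto
    moreover have "finite {k. k \<ge> 1 \<and> y \<le> pmf (P undefined) k}"
      by (rule finite_subset[OF _ finite_pmf_ge[OF y(1), of "P undefined"]]) auto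
    ultimately have "0 < real (card {k. k \<ge> 1 \<and> y \<le> pmf (P undefined) k})"
      by (auto simp: card_gt_0_iff)
    also have "\<dots> \<le> y powr (- \<alpha>) * L (1 / y)" by (rule counting'[OF y(1,2)])
    finally have "0 < L (1 / y)" using y(1) by (simp add: zero_less_mult_iff)
    also have "\<dots> \<le> L x" using y that by (intro monotone_onD[OF L(1)]) (auto simp: field_simps)
    finally show ?thesis .
  qed
  have hpos: "0 < h x" if "0 < x" for x using Lpos[OF that] that by (simp add: h_def)
  have hmono: "h y \<le> h x" if "0 < x" "x \<le> y" for x y
    unfolding h_def using that \<alpha> Lpos[of y]
    by (intro mult_mono powr_mono2' monotone_onD[OF L(1)]) auto

  have pi_le: "pi_min \<pi> \<le> pmf \<pi> a" for a by (simp add: pi_min_def)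
  then have pi_pos: "0 < pmf \<pi> a" for a using \<epsilon> by (meson less_le_trans less_trans)
  have pi1: "pi_min \<pi> \<le> 1" using pi_le[of undefined] pmf_le_1[of \<pi> undefined] by linarith
  have lam: "0 < lam" "lam \<le> 1"
    using mixing_const_pos[OF t0(2) pi_pos] by (auto simp: lam_def mixing_const_le_1)
  have n1: "(2 * real t0 + real r * lam + lam * (1 - pi_min \<pi>)) / (lam * pi_min \<pi>) < real n"
    and n2: "(2 * real t0 + 0 * lam + lam * (1 - pi_min \<pi>)) / (lam * (pi_min \<pi> - \<epsilon>)) < real n"
    using n by (simp_all add: lam_def)
  have "0 < (2 * real t0 + real r * lam + lam * (1 - pi_min \<pi>)) / (lam * pi_min \<pi>)"
    using lam pi1 \<epsilon> t0(1) by (intro divide_pos_pos add_pos_nonneg mult_pos_pos mult_nonneg_nonneg) auto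
  with n1 have n0: "n \<ge> 1" by linarith
  have C0: "0 \<le> C"
  proof -
    have "0 \<le> pmf \<eta> undefined / pmf \<pi> undefined" by simp
    also have "\<dots> \<le> (MAX a. pmf \<eta> a / pmf \<pi> a)" by (intro Max_ge) auto
    finally show ?thesis by (simp add: C_def init_const_def)
  qed

  note tail = visits_le_tail[where \<eta> = \<eta>, OF stationary t0 less_trans[OF \<epsilon>] n0 refl refl, folded lam_def C_def]
  have tail2: "measure_pmf.prob (path_pmf \<eta> Q n) {xs. real (count_list (tl xs) (hd xs)) \<le> real r} \<le> C * e2"
  proof -
    have "measure_pmf.prob (path_pmf \<eta> Q n) {xs. real (count_list (tl xs) (hd xs)) \<le> real r}
        \<le> C * exp (- 2 * (real n * pi_min \<pi> - real r - real t0 / lam)\<^sup>2 / (real n * (real t0 / lam)\<^sup>2))"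
      using tail_exponent(1)[OF lam _ _ pi1 n0 n1] \<epsilon> t0(1) by (intro tail) auto
    also have "\<dots> \<le> C * e2"
      unfolding e2_def using tail_exponent(2)[OF lam _ _ pi1 n0 n1] \<epsilon> t0(1) C0 by (intro mult_left_mono) auto
    finally show ?thesis .
  qed
  have tail3: "measure_pmf.prob (path_pmf \<eta> Q n) {xs. real (count_list (tl xs) (hd xs)) \<le> real n * \<epsilon>} \<le> C * e3"
  proof -
    \<comment> \<open>The threshold \<open>n * \<epsilon>\<close> is absorbed into
      \<open>v = pi_min \<pi> - \<epsilon>\<close>, so that \<open>tail_exponent\<close> applies
      with \<open>x = 0\<close>.\<close>
    have D: "real n * (pi_min \<pi> - \<epsilon>) - 0 - real t0 / lam = real n * pi_min \<pi> - real n * \<epsilon> - real t0 / lam"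
      by (simp add: algebra_simps)
    have "measure_pmf.prob (path_pmf \<eta> Q n) {xs. real (count_list (tl xs) (hd xs)) \<le> real n * \<epsilon>}
        \<le> C * exp (- 2 * (real n * pi_min \<pi> - real n * \<epsilon> - real t0 / lam)\<^sup>2 / (real n * (real t0 / lam)\<^sup>2))"
      using tail_exponent(1)[OF lam _ _ pi1 n0 n2] \<epsilon> t0(1) unfolding D by (intro tail) auto
    also have "\<dots> \<le> C * e3"
      unfolding e3_def using tail_exponent(2)[OF lam _ _ pi1 n0 n2] \<epsilon> t0(1) C0 unfolding D
      by (intro mult_left_mono) auto
    finally show ?thesis .
  qed

  have psup: "pmf (P a) k \<le> p_sup P" if "k \<ge> 1" for a k
    unfolding p_sup_def using that
    by (intro cSUP_upper2[of _ _ "(a, k)"]) (auto intro!: bdd_aboveI[of _ 1] simp: pmf_le_1)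
  have diag: "match_prob (P a) r r \<le> c2 P L \<alpha> r" for a
  proof (cases "r = 0")
    case True
    then show ?thesis by (simp add: c2_def match_prob_def pmf_le_1)
  next
    case False
    then show ?thesis using match_prob_diag_le[OF letters counting' psup, of r a] by (simp add: c2_def)
  qed
  have mp0: "0 \<le> match_prob p m j" for p m j
    unfolding match_prob_def by (intro integral_nonneg_AE) (simp del: pmf_binomial)
  have c2: "0 \<le> c2 P L \<alpha> r" using diag[of undefined] mp0 order.trans by blast
  have c0: "0 \<le> c0 r" by (simp add: c0_def)
  have q: "0 < q" by (simp add: q_def)

  show ?thesis
  proof (cases "G = \<top>")
    \<comment> \<open>This occurs for \<open>\<alpha> = 1\<close> and \<open>r = 0\<close>. Since
      \<open>\<infinity> * 0 = 0\<close>, it is the strict positivity of \<open>h\<close> that makes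
      the first summand infinite.\<close>
    case True
    then have "c1 \<alpha> r = \<infinity>" using q by (simp add: c1_def G_def q_def)
    then show ?thesis unfolding H using hpos[of "real n * \<epsilon>"] hpos[of "real r + 1"] \<epsilon> n0 c2 C0
      by (simp add: e3_def zero_less_mult_iff)
  next
    case False
    then obtain g where g: "0 \<le> g" "G = ennreal g" by (cases G) auto
    define c where "c = c0 r + q * g"
    have c: "0 \<le> c" using c0 q g by (simp add: c_def)
    have c1: "c1 \<alpha> r = ereal c"
      using g by (simp add: c1_def c_def q_def flip: G_def)
    have large: "match_prob (P a) m r \<le> c * h (real m)" if "r < m" for a m
    proof -
      have "ennreal (match_prob (P a) m r) \<le> (ennreal (c0 r) + ennreal q * ennreal g) * ennreal (h (real m))"
        using match_prob_le[OF letters L(1) counting' \<alpha> that, of a] Lpos[of "real m"] that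
        unfolding h_def q_def g(2)[symmetric] G_def by simp
      also have "\<dots> = ennreal (c * h (real m))"
        using c0 q g c hpos[of "real m"] that by (simp add: c_def ennreal_mult ennreal_plus)
      finally show ?thesis using c hpos[of "real m"] that by (subst (asm) ennreal_le_iff) auto
    qed
    \<comment> \<open>Here \<open>m\<close> is the number of earlier visits. For
      \<open>m < r\<close> there is nothing to bound; \<open>m = r\<close> is charged to
      \<open>c2\<close>; between \<open>r + 1\<close> and \<open>n * \<epsilon>\<close> the rate is
      at most \<open>h (r + 1)\<close>, and beyond \<open>n * \<epsilon>\<close> at most
      \<open>h (n * \<epsilon>)\<close>. These are the three summands of the final bound.\<close>
    have pointwise: "match_prob (P a) m r \<le> c * h (real n * \<epsilon>) + c2 P L \<alpha> r * of_bool (real m \<le> real r)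
        + c * h (real r + 1) * of_bool (real m \<le> real n * \<epsilon>)" for a m
    proof -
      have nn: "0 \<le> c * h (real n * \<epsilon>)" "0 \<le> c * h (real r + 1)"
        using c hpos[of "real n * \<epsilon>"] hpos[of "real r + 1"] \<epsilon> n0 by auto
      consider "m < r" | "m = r" | "r < m" "real m \<le> real n * \<epsilon>" | "r < m" "real n * \<epsilon> < real m" by linarith
      then show ?thesis
      proof cases
        case 1
        then show ?thesis using nn c2 by (simp add: match_prob_eq_0)
      next
        case 2
        then show ?thesis using nn diag[of a] by (simp add: add_increasing add_increasing2)
      next
        case 3
        have "c * h (real m) \<le> c * h (real r + 1)" using 3 c by (intro mult_left_mono hmono) auto
        then show ?thesis using 3 nn large[OF 3(1), of a] by simp
      next
        case 4
        have "c * h (real m) \<le> c * h (real n * \<epsilon>)" using 4 c \<epsilon> n0 by (intro mult_left_mono hmono) auto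
        then show ?thesis using 4 large[OF 4(1), of a] by simp
      qed
    qed
    let ?p = "path_pmf \<eta> Q n" and ?N = "\<lambda>xs. real (count_list (tl xs) (hd xs))"
    note int = integrable_measure_pmf_finite[OF finite_path_pmf[of \<eta> Q n]]
    have "\<P>(w in M. num_matches Z n w = r) = measure_pmf.expectation ?p (\<lambda>xs. match_prob (P (hd xs)) (count_list (tl xs) (hd xs)) r)"
      by (rule prob_num_matches[OF Z letters])
    also have "\<dots> \<le> measure_pmf.expectation ?p (\<lambda>xs. c * h (real n * \<epsilon>) + c2 P L \<alpha> r * indicator {xs. ?N xs \<le> real r} xs
        + c * h (real r + 1) * indicator {xs. ?N xs \<le> real n * \<epsilon>} xs)"
      by (intro integral_mono int) (use pointwise in \<open>auto simp: indicator_def of_bool_def\<close>)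
    also have "\<dots> = c * h (real n * \<epsilon>) + c2 P L \<alpha> r * measure_pmf.prob ?p {xs. ?N xs \<le> real r}
        + c * h (real r + 1) * measure_pmf.prob ?p {xs. ?N xs \<le> real n * \<epsilon>}"
      by (simp add: Bochner_Integration.integral_add[OF int int])
    also have "\<dots> \<le> c * h (real n * \<epsilon>) + c2 P L \<alpha> r * (C * e2) + c * h (real r + 1) * (C * e3)"
      using c c2 hpos[of "real r + 1"] by (intro add_mono mult_left_mono tail2 tail3) auto
    finally show ?thesis unfolding H c1 by (simp add: mult.assoc)
  qed
qed

end
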